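(* Let $k\ge1$, $m=2k$, $n\ge1$, $1\le l\le m-1$, and let $q$ be a nonzero complex number with $q^{8\binom{k}{2}}=1$. In the quantum matrix algebra $M_q(mn+l)$, extend the generator matrix $(a_{ij})_{1\le i,j\le mn+l}$ to an $m(n+1)\times m(n+1)$ matrix by setting, for $l<i\le m$: $a_{mn+i,j}=a_{j,mn+i}=0$ for all $j\ne mn+i$, and $a_{mn+i,mn+i}=1$. For $1\le i_1<\cdots<i_m\le m(n+1)$ put $$[i_1,i_2,\dots,i_m]_m=b_{i_1,i_2,\dots,i_m}=\sum_{i=1}^{n+1}\xi_{m(i-1)+1,\dots,mi}^{i_1,\dots,i_m},$$ the quantum minors being those of the extended matrix. Then $${\det}_q(a_{ij})_{1\le i,j\le mn+l}=[1,2,\dots,m(n+1)-1,m(n+1)]_m.$$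
   Context: $M_q(N)$ is the unital associative complex algebra generated by $a_{ij}$, $1\le i,j\le N$, subject to the relations, for all $i<j$ and $k<l$: $a_{ik}a_{il}=qa_{il}a_{ik}$, $a_{ik}a_{jk}=qa_{jk}a_{ik}$, $a_{jk}a_{il}=a_{il}a_{jk}$, $a_{ik}a_{jl}-a_{jl}a_{ik}=(q-q^{-1})a_{il}a_{jk}$. For a matrix $(a_{ij})$ with entries in an algebra and $i_1<\cdots<i_s$, $j_1<\cdots<j_s$, the quantum minor (rows on top, columns below) is $\xi^{i_1,\dots,i_s}_{j_1,\dots,j_s}=\sum_{\sigma\in S_s}(-q)^{l(\sigma)}a_{i_1,j_{\sigma(1)}}\cdots a_{i_s,j_{\sigma(s)}}$, with $l(\sigma)$ the number of inversions; ${\det}_q(a_{ij})_{1\le i,j\le N}=\xi^{1,\dots,N}_{1,\dots,N}$. Quantum hyper-Pfaffian of order $n+1$: given elements $b_{i_1,\dots,i_m}$ ($1\le i_1<\cdots<i_m\le m(n+1)$) of an associative algebra, put $[i_1,\dots,i_m]_m=b_{i_1,\dots,i_m}$ and, for $s_1<\cdots<s_{mp}$ in $\{1,\dots,m(n+1)\}$ with $p\ge 2$, inductively $$[s_1,\dots,s_{mp}]_m=\sum_{1<j_2<\cdots<j_m\le mp}(-q)^{\sum_{t=2}^m(j_t-t)}[s_1,s_{j_2},\dots,s_{j_m}]_m\,[s_2,\dots,\widehat{s_{j_2}},\dots,\widehat{s_{j_m}},\dots,s_{mp}]_m$$ (hats mean omitted entries). The quantum hyper-Pfaffian is $[1,2,\dots,m(n+1)]_m$.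 *)

theory Defs
  imports
    Complex_Main
    "HOL-Library.Poly_Mapping"
    "HOL-Combinatorics.Permutations"
    "HOL-Algebra.Module"
    "HOL-Algebra.QuotRing"
begin

section \<open>Free associative algebras\<close>

text \<open>
  Words form the free monoid, written additively because \<open>poly_mapping\<close> gets its convolution
  product from \<open>monoid_add\<close>.
\<close>

datatype 'x word = Word (letters: "'x list")

instantiation word :: (type) monoid_add
begin

definition zero_word :: "'a word"
  where "0 = Word []"

definition plus_word :: "'a word \<Rightarrow> 'a word \<Rightarrow> 'a word"
  where "u + v = Word (letters u @ letters v)"

instance
  by standard (auto simp: zero_word_def plus_word_def)

end

type_synonym 'x noncomm_poly = "'x word \<Rightarrow>\<^sub>0 complex"

abbreviation Const :: "complex \<Rightarrow> 'x noncomm_poly"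
  where "Const c \<equiv> Poly_Mapping.single 0 c"

definition Var :: "'x \<Rightarrow> 'x noncomm_poly"
  where "Var x = Poly_Mapping.single (Word [x]) 1"

text \<open>
  Complex algebras are represented by the record type \<open>module\<close>, which has both the ring and the
  scalar operations; only the locale of the same name assumes the ring to be commutative.
\<close>

definition free_algebra :: "'x set \<Rightarrow> (complex, 'x noncomm_poly) module"
  where "free_algebra X =
    \<lparr>carrier = {p. \<forall>w \<in> Poly_Mapping.keys p. set (letters w) \<subseteq> X},
     mult = (*), one = 1, zero = 0, add = (+), smult = (\<lambda>c p. Const c * p)\<rparr>"

definition quotient_algebra ::
    "(complex, 'a) module \<Rightarrow> 'a set \<Rightarrow> (complex, 'a set) module"
  where "quotient_algebra A I =
    ring.extend (A Quot I) (module.fields (\<lambda>c U. \<Union>x\<in>U. I +>\<^bsub>A\<^esub> (c \<odot>\<^bsub>A\<^esub> x)))"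


section \<open>The quantum matrix algebra\<close>

definition qmat_relations :: "complex \<Rightarrow> nat \<Rightarrow> (nat \<times> nat) noncomm_poly set"
  where "qmat_relations q N =
    (let a = (\<lambda>i j. Var (i, j)) in
      {a i k * a i l - Const q * a i l * a i k | i k l.
         i \<in> {1..N} \<and> k \<in> {1..N} \<and> l \<in> {1..N} \<and> k < l} \<union>
      {a i k * a j k - Const q * a j k * a i k | i j k.
         i \<in> {1..N} \<and> j \<in> {1..N} \<and> k \<in> {1..N} \<and> i < j} \<union>
      {a j k * a i l - a i l * a j k | i j k l.
         i \<in> {1..N} \<and> j \<in> {1..N} \<and> k \<in> {1..N} \<and> l \<in> {1..N} \<and> i < j \<and> k < l} \<union>
      {a i k * a j l - a j l * a i k - Const (q - inverse q) * a i l * a j k | i j k l.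
         i \<in> {1..N} \<and> j \<in> {1..N} \<and> k \<in> {1..N} \<and> l \<in> {1..N} \<and> i < j \<and> k < l})"

definition qmat_ideal :: "complex \<Rightarrow> nat \<Rightarrow> (nat \<times> nat) noncomm_poly set"
  where "qmat_ideal q N =
    genideal (free_algebra ({1..N} \<times> {1..N})) (qmat_relations q N)"

definition qmat_algebra :: "complex \<Rightarrow> nat \<Rightarrow> (complex, (nat \<times> nat) noncomm_poly set) module"
  where "qmat_algebra q N =
    quotient_algebra (free_algebra ({1..N} \<times> {1..N})) (qmat_ideal q N)"

definition qmat_gen :: "complex \<Rightarrow> nat \<Rightarrow> nat \<Rightarrow> nat \<Rightarrow> (nat \<times> nat) noncomm_poly set"
  where "qmat_gen q N i j =
    qmat_ideal q N +>\<^bsub>free_algebra ({1..N} \<times> {1..N})\<^esub> Var (i, j)"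

definition qmat_gen_ext :: "complex \<Rightarrow> nat \<Rightarrow> nat \<Rightarrow> nat \<Rightarrow> (nat \<times> nat) noncomm_poly set"
  where "qmat_gen_ext q N i j =
    (if i \<le> N \<and> j \<le> N then qmat_gen q N i j
     else if i = j then \<one>\<^bsub>qmat_algebra q N\<^esub>
     else \<zero>\<^bsub>qmat_algebra q N\<^esub>)"


section \<open>Quantum minors\<close>

definition num_inversions :: "nat \<Rightarrow> (nat \<Rightarrow> nat) \<Rightarrow> nat"
  where "num_inversions s \<sigma> = card {(u, v). u < v \<and> v < s \<and> \<sigma> v < \<sigma> u}"

definition list_mult :: "('a, 'b) monoid_scheme \<Rightarrow> 'a list \<Rightarrow> 'a"
  where "list_mult A xs = foldr (\<otimes>\<^bsub>A\<^esub>) xs \<one>\<^bsub>A\<^esub>"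

text \<open>Rows are listed in \<open>is\<close> and columns in \<open>js\<close>; list positions start at 0.\<close>

definition qminor ::
    "(complex, 'a) module \<Rightarrow> complex \<Rightarrow> (nat \<Rightarrow> nat \<Rightarrow> 'a) \<Rightarrow> nat list \<Rightarrow> nat list \<Rightarrow> 'a"
  where "qminor A q a is js =
    (\<Oplus>\<^bsub>A\<^esub>\<sigma> \<in> {\<sigma>. \<sigma> permutes {..<length is}}.
       (- q) ^ num_inversions (length is) \<sigma> \<odot>\<^bsub>A\<^esub>
         list_mult A (map (\<lambda>r. a (is ! r) (js ! \<sigma> r)) [0..<length is]))"

definition qdet :: "(complex, 'a) module \<Rightarrow> complex \<Rightarrow> (nat \<Rightarrow> nat \<Rightarrow> 'a) \<Rightarrow> nat \<Rightarrow> 'a"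
  where "qdet A q a N = qminor A q a [1..<Suc N] [1..<Suc N]"


section \<open>Quantum hyper-Pfaffians\<close>

text \<open>
  \<open>qbracket A q m b n [s\<^sub>1, \<dots>, s\<^sub>m\<^sub>p]\<close> is the bracket with \<open>p = n + 1\<close> blocks of \<open>m\<close> entries. The
  choice \<open>1 < j\<^sub>2 < \<dots> < j\<^sub>m \<le> mp\<close> is encoded by the set \<open>J\<close> of its members, so that \<open>j\<^sub>t\<close> is
  entry \<open>t - 2\<close> of the sorted list of \<open>J\<close>; since \<open>j\<^sub>t \<ge> t\<close>, the subtraction \<open>j\<^sub>t - t\<close> never
  truncates.
\<close>

primrec qbracket ::
    "(complex, 'a) module \<Rightarrow> complex \<Rightarrow> nat \<Rightarrow> (nat list \<Rightarrow> 'a) \<Rightarrow> nat \<Rightarrow> nat list \<Rightarrow> 'a"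
where
  "qbracket A q m b 0 s = b s"
| "qbracket A q m b (Suc n) s =
    (\<Oplus>\<^bsub>A\<^esub>J \<in> {J. J \<subseteq> {2..m * (n + 2)} \<and> card J = m - 1}.
       (- q) ^ (\<Sum>t = 2..m. sorted_list_of_set J ! (t - 2) - t) \<odot>\<^bsub>A\<^esub>
         (b (map (\<lambda>j. s ! (j - 1)) (1 # sorted_list_of_set J)) \<otimes>\<^bsub>A\<^esub>
          qbracket A q m b n
            (map (\<lambda>j. s ! (j - 1)) (sorted_list_of_set ({2..m * (n + 2)} - J)))))"

definition qhyper_pfaffian ::
    "(complex, 'a) module \<Rightarrow> complex \<Rightarrow> nat \<Rightarrow> nat \<Rightarrow> (nat list \<Rightarrow> 'a) \<Rightarrow> 'a"
  where "qhyper_pfaffian A q m n b = qbracket A q m b n [1..<Suc (m * (n + 1))]"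

definition minor_sum ::
    "(complex, 'a) module \<Rightarrow> complex \<Rightarrow> (nat \<Rightarrow> nat \<Rightarrow> 'a) \<Rightarrow> nat \<Rightarrow> nat \<Rightarrow> nat list \<Rightarrow> 'a"
  where "minor_sum A q a m n is =
    (\<Oplus>\<^bsub>A\<^esub>i \<in> {1..n + 1}. qminor A q a is [m * (i - 1) + 1..<Suc (m * i)])"

end

theory Submission
  imports Defs
begin

text \<open>
  The extended matrix satisfies the relations of the quantum matrix algebra of size \<open>m (n + 1)\<close>. There
  a column-ordered quantum minor obeys the Laplace expansion along any splitting of its columns,
  and permuting columns out of order costs powers of \<open>-q\<close> or, for a repeated column, gives 0.
  The recursion of the bracket is a Laplace expansion restricted to the index sets containing the
  smallest row. Expanding the first minor along that row turns it into a sum of full Laplace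
  expansions: products of a minor with columns \<open>B\<close> and one whose columns contain \<open>B\<close> vanish, and the
  others carry the power of \<open>-q\<close> of the expansion of a larger minor along its first row, up to
  powers of \<open>q ^ (m (m - 2)) = 1\<close>. Hence the bracket with \<open>p\<close> blocks of rows is the sum of the minors over
  all choices of \<open>p\<close> blocks of columns, and for \<open>p = n + 1\<close> only the determinant is left.
\<close>

subsection \<open>Column-ordered minors modulo a congruence\<close>

text \<open>Column order makes Laplace expansion exact: the factors never have to be interchanged.
  The relations are therefore needed only for two adjacent columns at a time and for the expansion
  along the smallest row. The row-ordered minors of the theorem agree with the column-ordered ones
  because both obey that row expansion.

  The constant comes from the following count. Once the entry in column c of block i is split off,
  the other m - 1 columns of the block have to pass j lower blocks of the second factor, with
  exponent (m - 1) m j. In the row expansion of the larger minor only column c is compared with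
  these blocks, with exponent m j. The surplus is m (m - 2) j, and m (m - 2) = 4 k (k - 1) is 8
  times the binomial coefficient of k over 2.

  Computations take place on representatives in the free algebra, with \<open>z\<close> for -q and
  \<open>r\<close> for its inverse, so that \<open>r - z\<close> is the coefficient of the last
  relation. Only the resulting congruences are mapped to the quotient.\<close>

definition below :: "nat set \<Rightarrow> nat \<Rightarrow> nat"
  where "below S x = card {y \<in> S. y < x}"

text \<open>For finite sets, the number of inversions of the word listing \<open>J\<close> and then
  \<open>K\<close>, each increasingly: the exponent of a term in a Laplace expansion.\<close>

definition crossings :: "nat set \<Rightarrow> nat set \<Rightarrow> nat"
  where "crossings J K = (\<Sum>x\<in>J. below K x)"

lemma below_Un: "\<lbrakk>finite S; finite T; S \<inter> T = {}\<rbrakk> \<Longrightarrow> below (S \<union> T) x = below S x + below T x"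
  unfolding below_def by (subst card_Un_disjoint [symmetric]) (auto intro: arg_cong [where f = card])

lemma below_insert:
  "\<lbrakk>finite S; y \<notin> S\<rbrakk> \<Longrightarrow> below (insert y S) x = below S x + (if y < x then 1 else 0)"
proof -
  assume "finite S" "y \<notin> S"
  moreover have "{w \<in> insert y S. w < x} = (if y < x then insert y {w \<in> S. w < x} else {w \<in> S. w < x})"
    by auto
  ultimately show ?thesis by (simp add: below_def)
qed

lemma below_empty [simp]: "below {} x = 0"
  by (simp add: below_def)

lemma below_eq_0: "(\<And>y. y \<in> S \<Longrightarrow> x \<le> y) \<Longrightarrow> below S x = 0"
proof -
  assume "\<And>y. y \<in> S \<Longrightarrow> x \<le> y"
  then have "{y \<in> S. y < x} = {}" by force
  then show ?thesis by (simp add: below_def)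
qed

lemma crossings_insert_left:
  "\<lbrakk>finite J; x \<notin> J\<rbrakk> \<Longrightarrow> crossings (insert x J) K = below K x + crossings J K"
  by (simp add: crossings_def)

text \<open>The relation is only symmetric and transitive: the elements related to themselves play the part
  of the subalgebra on which the congruence lives.\<close>

locale qmatrix_cong =
  fixes rel :: "'r::ring_1 \<Rightarrow> 'r \<Rightarrow> bool"  (infix "\<approx>" 50)
    and a :: "nat \<Rightarrow> nat \<Rightarrow> 'r" and z r :: 'r
  assumes sym: "x \<approx> y \<Longrightarrow> y \<approx> x"
    and trans [trans]: "x \<approx> y \<Longrightarrow> y \<approx> w \<Longrightarrow> x \<approx> w"
    and one: "1 \<approx> 1"
    and diff: "x \<approx> y \<Longrightarrow> u \<approx> v \<Longrightarrow> x - u \<approx> y - v"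
    and mult: "x \<approx> y \<Longrightarrow> u \<approx> v \<Longrightarrow> x * u \<approx> y * v"
    and entry: "a i j \<approx> a i j" and z: "z \<approx> z"
    and central: "z * x = x * z" and inverse: "z * r = 1"
    and same_row: "k < l \<Longrightarrow> a i k * a i l \<approx> - z * a i l * a i k"
    and same_column: "i < j \<Longrightarrow> a i k * a j k \<approx> - z * a j k * a i k"
    and commute: "i < j \<Longrightarrow> k < l \<Longrightarrow> a j k * a i l \<approx> a i l * a j k"
    and cross: "i < j \<Longrightarrow> k < l \<Longrightarrow> a i k * a j l - a j l * a i k \<approx> (r - z) * a i l * a j k"
begin

lemma eq_rel_trans [trans]: "x = y \<Longrightarrow> y \<approx> w \<Longrightarrow> x \<approx> w"
  and rel_eq_trans [trans]: "x \<approx> y \<Longrightarrow> y = w \<Longrightarrow> x \<approx> w"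
  by simp_all

lemma zero: "0 \<approx> 0"
  using diff [OF one one] by simp

lemma uminus: "x \<approx> y \<Longrightarrow> - x \<approx> - y"
  using diff [OF zero] by force

lemma add: "x \<approx> y \<Longrightarrow> u \<approx> v \<Longrightarrow> x + u \<approx> y + v"
  using diff [of x y "- u" "- v"] uminus by force

lemma sum: "(\<And>x. x \<in> X \<Longrightarrow> f x \<approx> g x) \<Longrightarrow> sum f X \<approx> sum g X"
  by (induction X rule: infinite_finite_induct) (auto intro: add zero)

lemma power: "x \<approx> y \<Longrightarrow> x ^ n \<approx> y ^ n"
  by (induction n) (auto intro: mult one)

lemma z_power: "z ^ n \<approx> z ^ n"
  by (rule power [OF z])

lemma commute_z: "x * z ^ n = z ^ n * x"
  by (metis central power_commuting_commutes)

lemma commute_z': "x * (z ^ n * y) = z ^ n * (x * y)"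
  by (metis commute_z mult.assoc)

text \<open>The column-ordered quantum minor: the coefficient of \<open>x\<^sub>S\<close> in \<open>y\<^sub>c \<cdots>\<close>, \<open>c\<close> running through the
  word of columns, where \<open>y\<^sub>c = \<Sum>\<^sub>s a\<^sub>s\<^sub>c x\<^sub>s\<close> and \<open>x\<^sub>t x\<^sub>s = z x\<^sub>s x\<^sub>t\<close> for \<open>s < t\<close>.\<close>

primrec minor :: "nat set \<Rightarrow> nat list \<Rightarrow> 'r" where
  "minor S [] = (if S = {} then 1 else 0)"
| "minor S (c # w) = (\<Sum>s\<in>S. z ^ below S s * a s c * minor (S - {s}) w)"

lemma commute_z_minor:
  "a i j * z ^ n = z ^ n * a i j" "a i j * (z ^ n * y) = z ^ n * (a i j * y)"
  "minor S w * z ^ n = z ^ n * minor S w" "minor S w * (z ^ n * y) = z ^ n * (minor S w * y)"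
  by (rule commute_z commute_z')+

lemma minor_refl: "minor S w \<approx> minor S w"
  by (induction w arbitrary: S) (auto intro!: one zero sum mult z_power entry)

lemma minor_eq_0: "\<lbrakk>finite S; card S \<noteq> length w\<rbrakk> \<Longrightarrow> minor S w = 0"
proof (induction w arbitrary: S)
  case (Cons c w)
  have "minor (S - {s}) w = 0" if "s \<in> S" for s
    using card.remove [OF Cons.prems(1) that] Cons.prems by (intro Cons.IH) simp_all
  then show ?case by simp
qed auto

text \<open>\<open>J\<close> is the set of rows used by the columns of \<open>u\<close>. The
  identity is exact, since the factors already stand in column order and only powers of the central
  \<open>z\<close> are moved.\<close>

lemma minor_append:
  assumes "finite S"
  shows "minor S (u @ v) =
    (\<Sum>J\<in>Pow S. z ^ crossings J (S - J) * minor J u * minor (S - J) v)"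
  using assms
proof (induction u arbitrary: S)
  case Nil
  have "(\<Sum>J\<in>Pow S. z ^ crossings J (S - J) * minor J [] * minor (S - J) v) =
      (\<Sum>J\<in>{{}}. z ^ crossings J (S - J) * minor J [] * minor (S - J) v)"
    using Nil by (intro sum.mono_neutral_right) auto
  then show ?case by (simp add: crossings_def)
next
  case (Cons c u)
  have "minor S ((c # u) @ v) = (\<Sum>t\<in>S. \<Sum>J\<in>Pow (S - {t}).
      z ^ (below S t + crossings J (S - {t} - J)) * a t c * minor J u * minor (S - {t} - J) v)"
    using Cons by (simp add: sum_distrib_left mult.assoc power_add commute_z_minor)
  also have "\<dots> = (\<Sum>(t, J)\<in>(SIGMA t:S. Pow (S - {t})).
      z ^ (below S t + crossings J (S - {t} - J)) * a t c * minor J u * minor (S - {t} - J) v)"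
    using Cons.prems by (intro sum.Sigma) auto
  \<comment> \<open>The row \<open>t\<close> of column \<open>c\<close> joins the rows of the
    prefix. Its exponent counts all smaller rows of \<open>S\<close>: those of the prefix belong to
    the inner minor, the others to the crossings.\<close>
  also have "\<dots> = (\<Sum>(J, t)\<in>(SIGMA J:Pow S. J).
      z ^ (crossings J (S - J) + below J t) * a t c * minor (J - {t}) u * minor (S - J) v)"
  proof (rule sum.reindex_bij_witness [where i = "\<lambda>(J, t). (t, J - {t})" and j = "\<lambda>(t, J). (insert t J, t)"];
      clarsimp)
    fix t J assume t: "t \<in> S" and J: "J \<subseteq> S - {t}"
    have fin: "finite J" "t \<notin> J" using Cons.prems J finite_subset by auto
    have "S = insert t J \<union> (S - insert t J)" using t J by auto
    then have "below S t = below (insert t J) t + below (S - insert t J) t"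
      using below_Un [of "insert t J" "S - insert t J" t] Cons.prems fin by auto
    moreover have "S - {t} - J = S - insert t J" by auto
    ultimately have "crossings (insert t J) (S - insert t J) + below (insert t J) t =
        below S t + crossings J (S - {t} - J)"
      using fin by (simp add: crossings_insert_left)
    then show "z ^ (crossings (insert t J) (S - insert t J) + below (insert t J) t) * a t c *
        minor (J - {t}) u * minor (S - insert t J) v =
      z ^ (below S t + crossings J (S - {t} - J)) * a t c * minor J u * minor (S - {t} - J) v"
      using fin \<open>S - {t} - J = S - insert t J\<close> by simp
  qed auto
  also have "\<dots> = (\<Sum>J\<in>Pow S. \<Sum>t\<in>J.
      z ^ (crossings J (S - J) + below J t) * a t c * minor (J - {t}) u * minor (S - J) v)"
    using Cons.prems by (intro sum.Sigma [symmetric]) (auto intro: finite_subset)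
  also have "\<dots> = (\<Sum>J\<in>Pow S. z ^ crossings J (S - J) * minor J (c # u) * minor (S - J) v)"
    by (simp add: sum_distrib_left sum_distrib_right mult.assoc power_add)
  finally show ?case .
qed

text \<open>Collects the two ways of assigning a pair of rows to the first two columns. Removing the
  larger row first raises the exponent by one, which produces the 2 by 2 minors on which the
  relations act.\<close>

lemma minor_Cons2:
  assumes "finite S"
  shows "minor S (c # d # w) = (\<Sum>(i, j)\<in>{(i, j). i \<in> S \<and> j \<in> S \<and> i < j}.
    z ^ (below S i + below (S - {i}) j) * (a i c * a j d + z * a j c * a i d) * minor (S - {i, j}) w)"
    (is "_ = (\<Sum>(i, j)\<in>?P. ?f i j)")
proof -
  let ?g = "\<lambda>i j. z ^ (below S i + below (S - {i}) j) * a i c * a j d * minor (S - {i, j}) w"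
  have fin: "finite ?P" using assms by (rule_tac finite_subset [of _ "S \<times> S"]) auto
  have "minor S (c # d # w) = (\<Sum>i\<in>S. \<Sum>j\<in>S - {i}. ?g i j)"
    by (simp add: sum_distrib_left mult.assoc power_add commute_z_minor Diff_insert2 [symmetric] insert_commute)
  also have "\<dots> = (\<Sum>(i, j)\<in>(SIGMA i:S. S - {i}). ?g i j)"
    using assms by (intro sum.Sigma) auto
  also have "(SIGMA i:S. S - {i}) = ?P \<union> (\<lambda>(i, j). (j, i)) ` ?P"
    by (auto simp: image_iff)
  also have "(\<Sum>(i, j)\<in>\<dots>. ?g i j) = (\<Sum>(i, j)\<in>?P. ?g i j) + (\<Sum>(i, j)\<in>(\<lambda>(i, j). (j, i)) ` ?P. ?g i j)"
    using fin by (intro sum.union_disjoint) auto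
  also have "(\<Sum>(i, j)\<in>(\<lambda>(i, j). (j, i)) ` ?P. ?g i j) = (\<Sum>(i, j)\<in>?P. ?g j i)"
    by (subst sum.reindex) (auto simp: inj_on_def intro!: sum.cong)
  also have "(\<Sum>(i, j)\<in>?P. ?g i j) + \<dots> = (\<Sum>(i, j)\<in>?P. ?f i j)"
    unfolding sum.distrib [symmetric]
  proof (rule sum.cong [OF refl], clarify)
    fix i j assume ij: "i \<in> S" "j \<in> S" "i < j"
    have "below S j = below (S - {i}) j + 1"
      using below_insert [of "S - {i}" i j] ij assms by (simp add: insert_absorb)
    moreover have "below S i = below (S - {j}) i"
      using below_insert [of "S - {j}" j i] ij assms by (simp add: insert_absorb)
    ultimately have "below S j + below (S - {j}) i = below S i + below (S - {i}) j + 1"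
      by simp
    then show "?g i j + ?g j i = ?f i j"
      by (simp add: distrib_left distrib_right mult.assoc [symmetric] power_Suc2 [symmetric]
          insert_commute del: power_Suc)
  qed
  finally show ?thesis .
qed

text \<open>A prefix only contributes coefficients on the left, and the central \<open>x\<close> can
  be moved past them. The cases of interest are \<open>x = z\<close> for a swap and
  \<open>x = 0\<close> for a repeated column.\<close>

lemma minor_prefix_cong:
  assumes "\<And>S. finite S \<Longrightarrow> minor S v \<approx> x * minor S w" and "x \<approx> x" and "\<And>y. x * y = y * x"
  shows "finite S \<Longrightarrow> minor S (u @ v) \<approx> x * minor S (u @ w)"
proof (induction u arbitrary: S)
  case (Cons c u)
  have comm: "z ^ n * y * (x * w) = x * (z ^ n * y * w)" for n y w
    by (metis assms(3) mult.assoc)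
  have "minor S (c # u @ v) \<approx> (\<Sum>s\<in>S. z ^ below S s * a s c * (x * minor (S - {s}) (u @ w)))"
    using Cons by (auto intro!: sum mult z_power entry)
  also have "\<dots> = x * minor S (c # u @ w)"
    using comm by (simp add: sum_distrib_left)
  finally show ?case by simp
qed (use assms in auto)

text \<open>By \<open>minor_Cons2\<close> it suffices to compare the 2 by 2 minors in the two
  columns, for each pair of rows.\<close>

lemma minor_swap:
  assumes "c < d" "finite S"
  shows "minor S (u @ d # c # v) \<approx> z * minor S (u @ c # d # v)"
proof (rule minor_prefix_cong [OF _ z central assms(2)])
  fix S :: "nat set" assume fin: "finite S"
  have *: "a i d * a j c + z * a j d * a i c \<approx> z * (a i c * a j d + z * a j c * a i d)"
    if "i < j" for i j
  proof -
    have 1: "z * (a i c * a j d - a j d * a i c) \<approx> z * ((r - z) * a i d * a j c)"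
      by (rule mult [OF z cross [OF that assms(1)]])
    have 2: "z * (z * (a j c * a i d)) \<approx> z * (z * (a i d * a j c))"
      by (rule mult [OF z mult [OF z commute [OF that assms(1)]]])
    have 3: "z * a j d * a i c \<approx> z * a j d * a i c"
      by (intro mult z entry)
    \<comment> \<open>As \<open>z * r = 1\<close>, the coefficients \<open>z * (r - z)\<close> and
      \<open>z * z\<close> add up to 1. The first part is treated by \<open>cross\<close>, the
      second by \<open>commute\<close>.\<close>
    have "a i d * a j c + z * a j d * a i c =
        z * ((r - z) * a i d * a j c) + z * (z * (a i d * a j c)) + z * a j d * a i c"
      by (simp add: algebra_simps) (simp add: mult.assoc [symmetric] inverse)
    also have "\<dots> \<approx> z * (a i c * a j d - a j d * a i c) + z * (z * (a j c * a i d)) + z * a j d * a i c"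
      by (intro add sym [OF 1] sym [OF 2] 3)
    also have "\<dots> = z * (a i c * a j d + z * a j c * a i d)"
      by (simp add: algebra_simps)
    finally show ?thesis .
  qed
  have "minor S (d # c # v) \<approx> (\<Sum>(i, j)\<in>{(i, j). i \<in> S \<and> j \<in> S \<and> i < j}.
    z ^ (below S i + below (S - {i}) j) * (z * (a i c * a j d + z * a j c * a i d)) * minor (S - {i, j}) v)"
    unfolding minor_Cons2 [OF fin] by (rule sum) (auto intro!: mult z_power * minor_refl)
  also have "\<dots> = z * minor S (c # d # v)"
    unfolding minor_Cons2 [OF fin]
    by (simp add: sum_distrib_left case_prod_unfold mult.assoc [symmetric] power_commutes)
  finally show "minor S (d # c # v) \<approx> z * minor S (c # d # v)" .
qed

text \<open>In each 2 by 2 minor of \<open>minor_Cons2\<close> the two products cancel by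
  \<open>same_column\<close>.\<close>

lemma minor_repeat:
  assumes "finite S"
  shows "minor S (u @ c # c # v) \<approx> 0"
proof -
  \<comment> \<open>The factor 0 brings the claim into the form required by
    \<open>minor_prefix_cong\<close>.\<close>
  have "minor S (c # c # v) \<approx> 0 * minor S v" if "finite S" for S
  proof -
    have *: "a i c * a j c + z * a j c * a i c \<approx> 0" if "i < j" for i j
    proof -
      have "a i c * a j c + z * a j c * a i c \<approx> - z * a j c * a i c + z * a j c * a i c"
        by (intro add same_column that mult z entry)
      then show ?thesis by simp
    qed
    have "z ^ n * (a i c * a j c + z * a j c * a i c) * minor T v \<approx> 0" if "i < j" for i j n T
      using mult [OF mult [OF z_power [of n] * [OF that]] minor_refl [of T v]] by simp
    then have "minor S (c # c # v) \<approx> (\<Sum>(i, j)\<in>{(i, j). i \<in> S \<and> j \<in> S \<and> i < j}. 0)"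
      unfolding minor_Cons2 [OF that] by (intro sum) auto
    then show ?thesis by simp
  qed
  from minor_prefix_cong [OF this zero _ assms, of u] show ?thesis by simp
qed

end

section \<open>Sorted lists and blocks of columns\<close>

abbreviation sorted_list :: "nat set \<Rightarrow> nat list"
  where "sorted_list \<equiv> sorted_list_of_set"

lemma sorted_list_of_set_Un:
  fixes D E :: "nat set"
  assumes "finite D" "finite E" "\<And>x y. \<lbrakk>x \<in> D; y \<in> E\<rbrakk> \<Longrightarrow> x < y"
  shows "sorted_list_of_set (D \<union> E) = sorted_list_of_set D @ sorted_list_of_set E"
  using assms by (intro strict_sorted_equal) (auto simp: sorted_wrt_append)

lemma sorted_list_of_set_insert_min:
  fixes D :: "nat set"
  shows "\<lbrakk>finite D; \<And>y. y \<in> D \<Longrightarrow> x < y\<rbrakk> \<Longrightarrow> sorted_list_of_set (insert x D) = x # sorted_list_of_set D"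
  using sorted_list_of_set_Un [of "{x}" D] by simp

lemma sorted_list_of_set_insert_max:
  fixes D :: "nat set"
  shows "\<lbrakk>finite D; \<And>y. y \<in> D \<Longrightarrow> y < x\<rbrakk> \<Longrightarrow> sorted_list_of_set (insert x D) = sorted_list_of_set D @ [x]"
  using sorted_list_of_set_Un [of D "{x}"] by simp

declare sorted_list_of_set_insert_remove [simp del]

text \<open>Blocks are numbered from 1. Truncated subtraction makes block 0 empty, which is why 0 is
  excluded wherever sizes matter.\<close>

definition block :: "nat \<Rightarrow> nat \<Rightarrow> nat set"
  where "block m i = {m * (i - 1) + 1..m * i}"

definition blocks :: "nat \<Rightarrow> nat set \<Rightarrow> nat set"
  where "blocks m T = (\<Union>i\<in>T. block m i)"

lemma finite_block [simp]: "finite (block m i)"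
  by (simp add: block_def)

lemma finite_blocks [simp]: "finite T \<Longrightarrow> finite (blocks m T)"
  by (simp add: blocks_def)

lemma card_block: "0 < i \<Longrightarrow> card (block m i) = m"
  by (cases i) (simp_all add: block_def)

lemma blocks_insert: "blocks m (insert i T) = block m i \<union> blocks m T"
  by (simp add: blocks_def)

lemma block_less: "\<lbrakk>i < j; x \<in> block m i; y \<in> block m j\<rbrakk> \<Longrightarrow> x < y"
proof -
  assume "i < j" "x \<in> block m i" "y \<in> block m j"
  moreover have "m * i \<le> m * (j - 1)" using \<open>i < j\<close> by (intro mult_le_mono2) simp
  ultimately show ?thesis unfolding block_def atLeastAtMost_iff by linarith
qed

lemma block_inject: "\<lbrakk>x \<in> block m i; x \<in> block m j\<rbrakk> \<Longrightarrow> i = j"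
  using block_less [of i j x m x] block_less [of j i x m x] by (metis less_irrefl linorder_neqE_nat)

text \<open>Blocks are consecutive intervals, so each block of \<open>T\<close> lies wholly below or
  wholly above \<open>x\<close>.\<close>

lemma below_blocks:
  assumes "finite T" "0 \<notin> T" "i \<notin> T" "x \<in> block m i"
  shows "below (blocks m T) x = m * card {t \<in> T. t < i}"
proof -
  have "{y \<in> blocks m T. y < x} = (\<Union>t\<in>{t \<in> T. t < i}. block m t)"
  proof (intro equalityI subsetI)
    fix y assume "y \<in> {y \<in> blocks m T. y < x}"
    then obtain t where t: "t \<in> T" "y \<in> block m t" "y < x" by (auto simp: blocks_def)
    moreover have "\<not> i < t" using block_less [of i t x m y] assms(4) t by auto
    ultimately have "t < i" using assms(3) by (cases "t = i") auto
    then show "y \<in> (\<Union>t\<in>{t \<in> T. t < i}. block m t)" using t by blast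
  next
    fix y assume "y \<in> (\<Union>t\<in>{t \<in> T. t < i}. block m t)"
    then show "y \<in> {y \<in> blocks m T. y < x}"
      using block_less [OF _ _ assms(4)] by (auto simp: blocks_def)
  qed
  moreover have "card (\<Union>t\<in>{t \<in> T. t < i}. block m t) = (\<Sum>t\<in>{t \<in> T. t < i}. card (block m t))"
    using assms by (intro card_UN_disjoint) (auto dest: block_inject)
  moreover have "\<dots> = (\<Sum>t\<in>{t \<in> T. t < i}. m)"
    using assms(2) by (intro sum.cong refl card_block) (auto intro: gr0I)
  ultimately show ?thesis by (simp add: below_def)
qed

section \<open>Row expansion, merging of column words, and the bracket\<close>

context qmatrix_cong
begin

text \<open>If the smallest column \<open>d\<close> takes a row \<open>t\<close> other than
  \<open>s\<close>, the induction hypothesis places \<open>s\<close> in a later column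
  \<open>c\<close>. Since \<open>s < t\<close> and \<open>d < c\<close>, the entries
  \<open>a t d\<close> and \<open>a s c\<close> commute, so \<open>a s c\<close> can be brought to
  the front.\<close>

lemma minor_row_expansion:
  assumes "finite D" "finite S" "\<And>x. x \<in> S \<Longrightarrow> s < x"
  shows "minor (insert s S) (sorted_list D) \<approx>
    (\<Sum>c\<in>D. z ^ below D c * a s c * minor S (sorted_list (D - {c})))"
  using assms
proof (induction D arbitrary: S rule: finite_linorder_min_induct)
  case empty
  then show ?case by (simp add: zero)
next
  case (insert d D)
  have D: "d \<notin> D" "\<And>c. c \<in> D \<Longrightarrow> d < c" "finite D" using insert by auto
  have S: "s \<notin> S" "finite S" using insert.prems by auto
  have below_S: "below (insert s S) t = Suc (below S t)" if "t \<in> S" for t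
    using S insert.prems(2) [OF that] by (simp add: below_insert)
  have below_D: "below (insert d D) c = Suc (below D c)" if "c \<in> D" for c
    using D that by (simp add: below_insert)
  have 0: "below (insert s S) s = 0" "below (insert d D) d = 0"
    using insert.prems(2) D by (auto intro!: below_eq_0 dest: less_imp_le)
  have diff: "insert s S - {t} = insert s (S - {t})" if "t \<in> S" for t
    using that S by auto
  have sorted: "sorted_list (insert d D - {c}) = d # sorted_list (D - {c})" if "c \<in> D" for c
  proof -
    have "insert d D - {c} = insert d (D - {c})" using D that by auto
    then show ?thesis using sorted_list_of_set_insert_min [of "D - {c}" d] D by simp
  qed
  have sorted0: "sorted_list (insert d D) = d # sorted_list D"
    using D by (intro sorted_list_of_set_insert_min)
  have "minor (insert s S) (sorted_list (insert d D)) = a s d * minor S (sorted_list D) +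
      (\<Sum>t\<in>S. z ^ Suc (below S t) * a t d * minor (insert s (S - {t})) (sorted_list D))"
    unfolding sorted0 using S D 0 by (simp add: below_S diff del: power_Suc cong: sum.cong)
  also have "\<dots> \<approx> a s d * minor S (sorted_list D) + (\<Sum>t\<in>S. z ^ Suc (below S t) * a t d *
      (\<Sum>c\<in>D. z ^ below D c * a s c * minor (S - {t}) (sorted_list (D - {c}))))"
    using insert.prems by (intro add sum mult z_power entry minor_refl insert.IH) auto
  also have "\<dots> = a s d * minor S (sorted_list D) + (\<Sum>t\<in>S. \<Sum>c\<in>D.
      z ^ (Suc (below D c) + below S t) * (a t d * a s c) * minor (S - {t}) (sorted_list (D - {c})))"
    by (simp add: sum_distrib_left mult.assoc commute_z_minor power_add)
      (simp add: mult.assoc [symmetric] power_add [symmetric] add.commute)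
  also have "\<dots> \<approx> a s d * minor S (sorted_list D) + (\<Sum>t\<in>S. \<Sum>c\<in>D.
      z ^ (Suc (below D c) + below S t) * (a s c * a t d) * minor (S - {t}) (sorted_list (D - {c})))"
    using insert.prems D by (intro add sum mult z_power entry minor_refl commute) auto
  also have "\<dots> = a s d * minor S (sorted_list D) + (\<Sum>c\<in>D. \<Sum>t\<in>S.
      z ^ (Suc (below D c) + below S t) * (a s c * a t d) * minor (S - {t}) (sorted_list (D - {c})))"
    by (subst sum.swap) simp
  \<comment> \<open>With \<open>a s c\<close> in front, the sum over \<open>t\<close> is the
    expansion of a minor along its first column \<open>d\<close>.\<close>
  also have "\<dots> = a s d * minor S (sorted_list D) +
      (\<Sum>c\<in>D. z ^ Suc (below D c) * a s c * minor S (d # sorted_list (D - {c})))"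
    by (simp add: sum_distrib_left mult.assoc commute_z_minor power_add)
  also have "\<dots> = (\<Sum>c\<in>insert d D. z ^ below (insert d D) c * a s c *
      minor S (sorted_list (insert d D - {c})))"
    using D 0 by (simp add: below_D sorted del: power_Suc minor.simps cong: sum.cong)
  finally show ?case .
qed

text \<open>Each swap past a smaller column of \<open>E\<close> costs one \<open>z\<close>, and
  meeting \<open>d\<close> itself gives 0. The prefix is arbitrary because every column that is
  passed joins it.\<close>

lemma minor_insert_column:
  assumes "finite E" "finite S"
  shows "minor S (u @ d # sorted_list E) \<approx>
    (if d \<in> E then 0 else z ^ below E d * minor S (u @ sorted_list (insert d E)))"
  using assms(1)
proof (induction E arbitrary: u rule: finite_linorder_min_induct)
  case empty
  then show ?case by (simp add: minor_refl)
next
  case (insert e E)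
  have E: "e \<notin> E" "\<And>c. c \<in> E \<Longrightarrow> e < c" "finite E" using insert by auto
  then have sorted: "sorted_list (insert e E) = e # sorted_list E"
    by (intro sorted_list_of_set_insert_min)
  consider "d < e" | "d = e" | "e < d" by linarith
  then show ?case
  proof cases
    case 1
    then have "d < c" if "c \<in> insert e E" for c
      using that E(2) less_trans by blast
    moreover from this have "below (insert e E) d = 0" "d \<notin> insert e E"
      by (auto intro: below_eq_0 less_imp_le)
    ultimately show ?thesis
      using E sorted_list_of_set_insert_min [of "insert e E" d]
      by (simp add: minor_refl)
  next
    case 2
    then show ?thesis
      using E minor_repeat [OF assms(2), of u d "sorted_list E"] by (simp add: sorted)
  next
    case 3
    have "minor S (u @ d # sorted_list (insert e E)) \<approx> z * minor S ((u @ [e]) @ d # sorted_list E)"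
      using minor_swap [OF 3 assms(2), of u "sorted_list E"] by (simp add: sorted)
    also have "\<dots> \<approx> z * (if d \<in> E then 0 else z ^ below E d * minor S ((u @ [e]) @ sorted_list (insert d E)))"
      by (rule mult [OF z insert.IH])
    also have "\<dots> = (if d \<in> insert e E then 0
        else z ^ below (insert e E) d * minor S (u @ sorted_list (insert d (insert e E))))"
    proof -
      have "sorted_list (insert d (insert e E)) = e # sorted_list (insert d E)"
        using sorted_list_of_set_insert_min [of "insert d E" e] E 3
        by (auto simp: insert_commute)
      then show ?thesis
        using 3 E by (simp add: below_insert mult.assoc)
    qed
    finally show ?thesis .
  qed
qed

text \<open>The columns of \<open>D\<close> are inserted from the largest down. Those already
  inserted exceed the next one, so it passes only columns of the original \<open>E\<close>.\<close>

lemma minor_merge: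
  assumes "finite D" "finite E" "finite S"
  shows "minor S (sorted_list D @ sorted_list E) \<approx>
    (if D \<inter> E = {} then z ^ crossings D E * minor S (sorted_list (D \<union> E)) else 0)"
  using assms(1,2)
proof (induction D arbitrary: E rule: finite_linorder_max_induct)
  case empty
  then show ?case by (simp add: minor_refl crossings_def)
next
  case (insert d D)
  have D: "d \<notin> D" "finite D" using insert by auto
  have *: "minor S (sorted_list (insert d D) @ sorted_list E) \<approx>
      (if d \<in> E then 0 else z ^ below E d * minor S (sorted_list D @ sorted_list (insert d E)))"
    using minor_insert_column [OF insert.prems assms(3), of "sorted_list D" d] insert
    by (simp add: sorted_list_of_set_insert_max)
  show ?case
  proof (cases "d \<in> E")
    case True
    then show ?thesis using * by simp
  next
    case False
    have "crossings D (insert d E) = crossings D E"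
      unfolding crossings_def using insert False by (intro sum.cong) (auto simp: below_insert)
    moreover have "z ^ below E d * minor S (sorted_list D @ sorted_list (insert d E)) \<approx> z ^ below E d *
        (if D \<inter> insert d E = {} then z ^ crossings D (insert d E) * minor S (sorted_list (D \<union> insert d E)) else 0)"
      using insert.prems by (intro mult [OF z_power insert.IH]) auto
    ultimately have "z ^ below E d * minor S (sorted_list D @ sorted_list (insert d E)) \<approx>
        (if insert d D \<inter> E = {} then z ^ crossings (insert d D) E * minor S (sorted_list (insert d D \<union> E)) else 0)"
      using D False
      by (cases "D \<inter> E = {}") (simp_all add: crossings_insert_left power_add mult.assoc)
    then show ?thesis using trans [OF *] False by simp
  qed
qed

text \<open>Only index sets containing the smallest row occur: that row is split off from the first
  factor, and the remaining sum is a full Laplace expansion.\<close>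

lemma restricted_laplace:
  assumes "finite B" "finite S" "\<And>x. x \<in> S \<Longrightarrow> s < x"
  shows "(\<Sum>J\<in>Pow S. z ^ crossings (insert s J) (S - J) * minor (insert s J) (sorted_list B) * minor (S - J) w) \<approx>
    (\<Sum>c\<in>B. z ^ below B c * a s c * minor S (sorted_list (B - {c}) @ w))"
proof -
  have cross: "crossings (insert s J) (S - J) = crossings J (S - J)" if "J \<in> Pow S" for J
  proof -
    have "below (S - J) s = 0" using assms(3) by (intro below_eq_0) (auto dest: less_imp_le)
    then show ?thesis
      using that assms(2) assms(3) [of s] by (subst crossings_insert_left) (auto intro: finite_subset)
  qed
  have "(\<Sum>J\<in>Pow S. z ^ crossings (insert s J) (S - J) * minor (insert s J) (sorted_list B) * minor (S - J) w) \<approx>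
      (\<Sum>J\<in>Pow S. z ^ crossings J (S - J) *
        (\<Sum>c\<in>B. z ^ below B c * a s c * minor J (sorted_list (B - {c}))) * minor (S - J) w)"
  proof (rule sum)
    fix J assume J: "J \<in> Pow S"
    then have "finite J" "\<And>x. x \<in> J \<Longrightarrow> s < x" using assms(2,3) finite_subset by auto
    then show "z ^ crossings (insert s J) (S - J) * minor (insert s J) (sorted_list B) * minor (S - J) w \<approx>
        z ^ crossings J (S - J) * (\<Sum>c\<in>B. z ^ below B c * a s c * minor J (sorted_list (B - {c}))) * minor (S - J) w"
      unfolding cross [OF J] by (intro mult z_power minor_refl minor_row_expansion assms(1))
  qed
  also have "\<dots> = (\<Sum>J\<in>Pow S. \<Sum>c\<in>B. z ^ below B c * a s c *
      (z ^ crossings J (S - J) * minor J (sorted_list (B - {c})) * minor (S - J) w))"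
    by (simp add: sum_distrib_left sum_distrib_right mult.assoc commute_z_minor)
      (simp add: mult.assoc [symmetric] power_add [symmetric] add.commute)
  also have "\<dots> = (\<Sum>c\<in>B. z ^ below B c * a s c * minor S (sorted_list (B - {c}) @ w))"
    by (subst sum.swap) (simp add: minor_append [OF assms(2)] sum_distrib_left)
  finally show ?thesis .
qed

text \<open>The recursion in terms of row sets: the exponent, a sum of differences of positions, is
  a number of crossings by \<open>sum_shift_eq_crossings\<close>, and this depends only on the
  relative order of the rows.\<close>

primrec bracket :: "nat \<Rightarrow> (nat set \<Rightarrow> 'r) \<Rightarrow> nat \<Rightarrow> nat set \<Rightarrow> 'r" where
  "bracket m b 0 S = b S"
| "bracket m b (Suc p) S = (\<Sum>J\<in>{J. J \<subseteq> S - {Min S} \<and> card J = m - 1}.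
    z ^ crossings (insert (Min S) J) (S - insert (Min S) J) *
      b (insert (Min S) J) * bracket m b p (S - insert (Min S) J))"

text \<open>Each set \<open>U\<close> of blocks arises once for every \<open>i\<close> in
  \<open>U\<close>, from block \<open>i\<close> in the first factor and the other blocks in the
  second. The pieces \<open>h i U\<close> together run through all columns of
  \<open>blocks m U\<close> and so form the row expansion of the minor with these columns.\<close>

lemma bracket_eq_sum_minor:
  assumes m: "2 \<le> m" and root: "z ^ (m * (m - 2)) = 1"
    and K: "finite K" "0 \<notin> K"
    and S: "finite S" "card S = m * (p + 1)"
  shows "bracket m (\<lambda>I. \<Sum>i\<in>K. minor I (sorted_list (block m i))) p S \<approx>
    (\<Sum>T\<in>{T. T \<subseteq> K \<and> card T = p + 1}. minor S (sorted_list (blocks m T)))"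
  using S
proof (induction p arbitrary: S)
  case 0
  have "{T. T \<subseteq> K \<and> card T = 1} = (\<lambda>i. {i}) ` K"
    by (auto simp: card_1_singleton_iff)
  then show ?case
    by (simp add: sum.reindex blocks_def sum minor_refl)
next
  case (Suc p)
  let ?b = "\<lambda>I. \<Sum>i\<in>K. minor I (sorted_list (block m i))"
  let ?T = "{T. T \<subseteq> K \<and> card T = p + 1}" and ?U = "{U. U \<subseteq> K \<and> card U = p + 2}"
  define s where "s = Min S"
  define S' where "S' = S - {s}"
  have ne: "S \<noteq> {}" using Suc.prems m by auto
  have s: "s \<in> S" "finite S'" "s \<notin> S'"
    using Min_in [OF Suc.prems(1) ne] Suc.prems(1) by (simp_all add: s_def S'_def)
  have less: "s < x" if "x \<in> S'" for x
    using Min_le [OF Suc.prems(1), of x] that by (simp add: s_def S'_def)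
  have S_eq: "S = insert s S'" using s by (auto simp: S'_def)
  have diff: "S - insert s J = S' - J" for J by (auto simp: S'_def)
  define f where "f J i T = z ^ crossings (insert s J) (S' - J) * minor (insert s J) (sorted_list (block m i)) *
      minor (S' - J) (sorted_list (blocks m T))" for J i T
  define g where "g i T = (\<Sum>c\<in>block m i. z ^ below (block m i) c * a s c *
      minor S' (sorted_list (block m i - {c}) @ sorted_list (blocks m T)))" for i T
  define h where "h i U = (\<Sum>c\<in>block m i. z ^ below (blocks m U) c * a s c *
      minor S' (sorted_list (blocks m U - {c})))" for i U
  have fin: "finite T" if "T \<subseteq> K" for T using that K(1) by (rule finite_subset)
  have pos: "0 < i" if "i \<in> K" for i using that K(2) by (cases i) auto
  have "bracket m ?b (Suc p) S = (\<Sum>J\<in>{J. J \<subseteq> S' \<and> card J = m - 1}.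
      z ^ crossings (insert s J) (S' - J) * ?b (insert s J) * bracket m ?b p (S' - J))"
    by (simp add: s_def [symmetric] S'_def [symmetric] diff)
  also have "\<dots> \<approx> (\<Sum>J\<in>{J. J \<subseteq> S' \<and> card J = m - 1}.
      z ^ crossings (insert s J) (S' - J) * ?b (insert s J) * (\<Sum>T\<in>?T. minor (S' - J) (sorted_list (blocks m T))))"
  proof (intro sum mult z_power minor_refl Suc.IH)
    fix J assume J: "J \<in> {J. J \<subseteq> S' \<and> card J = m - 1}"
    have "card S' = m * (Suc p + 1) - 1" using Suc.prems s by (simp add: S'_def)
    then show "card (S' - J) = m * (p + 1)"
      using J m s by (subst card_Diff_subset) (auto intro: finite_subset simp: algebra_simps)
  qed (use s in auto)
  \<comment> \<open>A full Laplace expansion runs over all subsets. Those of the wrong size add only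
    minors with unequal numbers of rows and columns, which vanish.\<close>
  also have "\<dots> = (\<Sum>J\<in>Pow S'.
      z ^ crossings (insert s J) (S' - J) * ?b (insert s J) * (\<Sum>T\<in>?T. minor (S' - J) (sorted_list (blocks m T))))"
  proof (intro sum.mono_neutral_left ballI)
    fix J assume "J \<in> Pow S' - {J. J \<subseteq> S' \<and> card J = m - 1}"
    then have "J \<subseteq> S'" "card J \<noteq> m - 1" by auto
    then have "finite J" "card (insert s J) \<noteq> m"
      using s finite_subset [of J S'] by (auto simp: card_insert_if)
    then have "minor (insert s J) (sorted_list (block m i)) = 0" if "i \<in> K" for i
      using card_block [OF pos [OF that], of m] by (intro minor_eq_0) auto
    then show "z ^ crossings (insert s J) (S' - J) * ?b (insert s J) *
        (\<Sum>T\<in>?T. minor (S' - J) (sorted_list (blocks m T))) = 0" by simp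
  qed (use s in auto)
  also have "\<dots> = (\<Sum>J\<in>Pow S'. \<Sum>i\<in>K. \<Sum>T\<in>?T. f J i T)"
    unfolding f_def sum_distrib_left sum_distrib_right by (intro sum.cong refl sum.swap)
  also have "\<dots> = (\<Sum>i\<in>K. \<Sum>J\<in>Pow S'. \<Sum>T\<in>?T. f J i T)"
    by (rule sum.swap)
  also have "\<dots> = (\<Sum>i\<in>K. \<Sum>T\<in>?T. \<Sum>J\<in>Pow S'. f J i T)"
    by (intro sum.cong refl sum.swap)
  also have "\<dots> \<approx> (\<Sum>i\<in>K. \<Sum>T\<in>?T. g i T)"
    unfolding f_def g_def using s less by (intro sum restricted_laplace) auto
  also have "\<dots> \<approx> (\<Sum>i\<in>K. \<Sum>T\<in>?T. if i \<in> T then 0 else h i (insert i T))"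
  proof (intro sum)
    fix i T assume i: "i \<in> K" and "T \<in> ?T"
    then have T: "finite T" "0 \<notin> T" "0 < i" using K fin pos by auto
    have merge: "z ^ below (block m i) c * a s c *
        minor S' (sorted_list (block m i - {c}) @ sorted_list (blocks m T)) \<approx>
        z ^ below (block m i) c * a s c * (if (block m i - {c}) \<inter> blocks m T = {}
          then z ^ crossings (block m i - {c}) (blocks m T) * minor S' (sorted_list (block m i - {c} \<union> blocks m T))
          else 0)" for c
      using T s by (intro mult z_power entry minor_merge) auto
    show "g i T \<approx> (if i \<in> T then 0 else h i (insert i T))"
    proof (cases "i \<in> T")
      case True
      have "(block m i - {c}) \<inter> blocks m T \<noteq> {}" for c
      proof -
        \<comment> \<open>As \<open>m\<close> is at least 2, some column of block \<open>i\<close>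
          survives the removal of \<open>c\<close> and occurs again in
          \<open>blocks m T\<close>.\<close>
        have "\<not> block m i \<subseteq> {c}"
          using card_mono [of "{c}" "block m i"] card_block [OF T(3), of m] m by auto
        then show ?thesis using True by (auto simp: blocks_def)
      qed
      then have "g i T \<approx> (\<Sum>c\<in>block m i. 0)"
        unfolding g_def using merge by (intro sum) simp
      then show ?thesis using True by simp
    next
      case False
      let ?k = "card {t \<in> T. t < i}"
      have disj: "block m i \<inter> blocks m T = {}"
        using False by (auto simp: blocks_def dest: block_inject)
      have "z ^ below (block m i) c * a s c * (if (block m i - {c}) \<inter> blocks m T = {}
          then z ^ crossings (block m i - {c}) (blocks m T) * minor S' (sorted_list (block m i - {c} \<union> blocks m T))
          else 0) = z ^ below (blocks m (insert i T)) c * a s c * minor S' (sorted_list (blocks m (insert i T) - {c}))"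
        if c: "c \<in> block m i" for c
      proof -
        have "block m i - {c} \<union> blocks m T = blocks m (insert i T) - {c}"
          using c disj by (auto simp: blocks_insert)
        moreover have "crossings (block m i - {c}) (blocks m T) = (m - 1) * (m * ?k)"
          using c T False card_block [OF T(3), of m]
          by (simp add: crossings_def below_blocks [where i = i] del: mult_cancel1 mult_cancel2)
        \<comment> \<open>Separates the exponent wanted for the row expansion from the surplus,
          which \<open>root\<close> removes.\<close>
        moreover have "(m - 1) * (m * ?k) = m * ?k + m * (m - 2) * ?k"
        proof -
          obtain d where "m = d + 2" using m by (metis add.commute le_Suc_ex)
          then show ?thesis by (simp add: algebra_simps)
        qed
        moreover have "below (blocks m (insert i T)) c = below (block m i) c + m * ?k"
          using c T False disj by (simp add: blocks_insert below_Un below_blocks [where i = i])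
        moreover have "z ^ (m * (m - 2) * ?k) = 1" by (subst power_mult) (simp only: root power_one)
        ultimately show ?thesis
          using disj by (auto simp: power_add mult.assoc commute_z_minor)
      qed
      then have "g i T \<approx> h i (insert i T)"
        unfolding g_def h_def by (intro sum rel_eq_trans [OF merge])
      then show ?thesis using False by simp
    qed
  qed
  also have "\<dots> = (\<Sum>(i, T)\<in>{(i, T). i \<in> K \<and> T \<in> ?T \<and> i \<notin> T}. h i (insert i T))"
  proof -
    have "(\<Sum>i\<in>K. \<Sum>T\<in>?T. if i \<in> T then 0 else h i (insert i T)) =
        (\<Sum>(i, T)\<in>K \<times> ?T. if i \<in> T then 0 else h i (insert i T))"
      by (rule sum.cartesian_product)
    also have "\<dots> = (\<Sum>(i, T)\<in>{(i, T). i \<in> K \<and> T \<in> ?T \<and> i \<notin> T}. h i (insert i T))"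
      using K by (intro sum.mono_neutral_cong_right) auto
    finally show ?thesis .
  qed
  \<comment> \<open>The pair \<open>(i, T)\<close> is recorded as the set
    \<open>U = insert i T\<close> with the marked element \<open>i\<close>.\<close>
  also have "\<dots> = (\<Sum>(U, i)\<in>(SIGMA U:?U. U). h i U)"
    by (rule sum.reindex_bij_witness [where i = "\<lambda>(U, i). (i, U - {i})" and j = "\<lambda>(i, T). (insert i T, i)"])
      (auto simp: fin insert_absorb)
  also have "\<dots> = (\<Sum>U\<in>?U. \<Sum>i\<in>U. h i U)"
    using K fin by (intro sum.Sigma [symmetric]) auto
  also have "\<dots> = (\<Sum>U\<in>?U. \<Sum>c\<in>blocks m U. z ^ below (blocks m U) c * a s c *
      minor S' (sorted_list (blocks m U - {c})))"
    unfolding h_def blocks_def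
    by (intro sum.cong refl sum.UNION_disjoint [symmetric]) (auto simp: fin dest: block_inject)
  also have "\<dots> \<approx> (\<Sum>U\<in>?U. minor S (sorted_list (blocks m U)))"
    unfolding S_eq using s less fin by (intro sum sym [OF minor_row_expansion]) auto
  finally show ?case by simp
qed

text \<open>Split off the last column: in these rows it consists of zeros and the 1 in row
  \<open>x\<close>, and \<open>x\<close>, being the largest row, causes no crossing.\<close>

lemma minor_extend:
  assumes "finite S" "\<And>y. y \<in> S \<Longrightarrow> y < x" "a x x = 1" "\<And>y. y \<in> S \<Longrightarrow> a y x = 0"
  shows "minor (insert x S) (w @ [x]) = minor S w"
proof -
  have x: "x \<notin> S" using assms(2) by blast
  have "minor (insert x S) (w @ [x]) = (\<Sum>J\<in>{S}. z ^ crossings J (insert x S - J) * minor J w * minor (insert x S - J) [x])"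
    unfolding minor_append [OF finite.insertI [OF assms(1)]]
  proof (rule sum.mono_neutral_right; (intro ballI)?)
    fix J assume J: "J \<in> Pow (insert x S) - {S}"
    have "minor (insert x S - J) [x] = 0"
    proof (simp, intro sum.neutral ballI)
      fix t assume t: "t \<in> insert x S - J"
      show "z ^ below (insert x S - J) t * a t x * (if insert x S - J \<subseteq> {t} then 1 else 0) = 0"
        using t J x assms(4) by auto
    qed
    then show "z ^ crossings J (insert x S - J) * minor J w * minor (insert x S - J) [x] = 0" by simp
  qed (use assms in auto)
  also have "\<dots> = minor S w"
  proof -
    have "below {x} y = 0" if "y \<in> S" for y using assms(2) [OF that] by (intro below_eq_0) auto
    moreover have "insert x S - S = {x}" using x by auto
    moreover have "below {x} x = 0" by (intro below_eq_0) auto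
    ultimately show ?thesis using assms by (simp add: crossings_def)
  qed
  finally show ?thesis .
qed

end

subsection \<open>Row-ordered minors and homomorphic images\<close>

lemma below_nth_sorted_list:
  assumes "finite D" "t < card D"
  shows "below D (sorted_list D ! t) = t"
proof -
  let ?xs = "sorted_list D"
  have "{y \<in> D. y < ?xs ! t} = (!) ?xs ` {..<t}"
  proof (intro equalityI subsetI)
    fix y assume y: "y \<in> {y \<in> D. y < ?xs ! t}"
    then obtain u where u: "u < length ?xs" "y = ?xs ! u"
      using assms(1) by (metis (no_types, lifting) in_set_conv_nth mem_Collect_eq set_sorted_list_of_set)
    have "\<not> t \<le> u"
      using y u sorted_nth_mono [OF sorted_sorted_list_of_set, of t u D] by auto
    then show "y \<in> (!) ?xs ` {..<t}" using u by auto
  next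
    fix y assume "y \<in> (!) ?xs ` {..<t}"
    then obtain u where u: "u < t" "y = ?xs ! u" by auto
    then have "?xs ! u < ?xs ! t" "?xs ! u \<in> set ?xs"
      using assms sorted_wrt_nth_less [OF strict_sorted_list_of_set, of u t D]
        nth_mem [of u ?xs] by (simp_all del: nth_mem)
    then show "y \<in> {y \<in> D. y < ?xs ! t}" using u assms(1) by auto
  qed
  moreover have "inj_on ((!) ?xs) {..<t}"
    using assms by (intro inj_on_nth) auto
  ultimately show ?thesis by (simp add: below_def card_image)
qed

lemma bij_betw_nth_sorted_list:
  "finite D \<Longrightarrow> bij_betw ((!) (sorted_list D)) {..<card D} D"
  using bij_betw_nth [of "sorted_list D" "{..<card D}" D] by simp

lemma map_sorted_list:
  assumes "strict_mono_on K f" "finite K"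
  shows "map f (sorted_list K) = sorted_list (f ` K)"
proof (rule strict_sorted_equal)
  show "sorted_wrt (<) (map f (sorted_list K))"
    unfolding sorted_wrt_map using assms
    by (intro sorted_wrt_mono_rel [OF _ strict_sorted_list_of_set]) (auto simp: strict_mono_on_def)
qed (use assms in auto)

lemma below_image:
  assumes "strict_mono_on X f" "K \<subseteq> X" "x \<in> X"
  shows "below (f ` K) (f x) = below K x"
proof -
  have "{y \<in> f ` K. y < f x} = f ` {y \<in> K. y < x}"
    using assms by (auto simp: strict_mono_on_less)
  moreover have "inj_on f {y \<in> K. y < x}"
    using strict_mono_on_imp_inj_on [OF assms(1)] assms(2) by (auto intro: inj_on_subset)
  ultimately show ?thesis by (simp add: below_def card_image)
qed

lemma crossings_image:
  assumes "strict_mono_on X f" "J \<subseteq> X" "K \<subseteq> X"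
  shows "crossings (f ` J) (f ` K) = crossings J K"
proof -
  have "inj_on f J"
    using strict_mono_on_imp_inj_on [OF assms(1)] assms(2) by (auto intro: inj_on_subset)
  then show ?thesis
    unfolding crossings_def using assms below_image [OF assms(1,3)]
    by (simp add: sum.reindex) (intro sum.cong refl, blast)
qed

text \<open>Of the \<open>j_t - 2\<close> numbers from 2 up to just below \<open>j_t\<close>,
  exactly \<open>t - 2\<close> lie in \<open>J\<close>. The other \<open>j_t - t\<close> are the
  crossings of \<open>j_t\<close> with the complement.\<close>

lemma sum_shift_eq_crossings:
  assumes J: "J \<subseteq> {2..M}" "card J = m - 1"
  shows "(\<Sum>t = 2..m. sorted_list J ! (t - 2) - t) = crossings J ({2..M} - J)"
proof -
  have fin: "finite J" using J(1) finite_subset by blast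
  have "below ({2..M} - J) j = j - 2 - below J j" if "j \<in> J" for j
  proof -
    have "below ({2..M} - J \<union> J) j = below ({2..M} - J) j + below J j"
      using fin by (intro below_Un) auto
    moreover have "{2..M} - J \<union> J = {2..M}" using J(1) by auto
    moreover have "{y \<in> {2..M}. y < j} = {2..<j}" using that J(1) by auto
    then have "below {2..M} j = j - 2" by (simp add: below_def)
    ultimately show ?thesis by simp
  qed
  then have "crossings J ({2..M} - J) = (\<Sum>j\<in>J. j - 2 - below J j)"
    by (simp add: crossings_def)
  also have "\<dots> = (\<Sum>i<card J. sorted_list J ! i - 2 - below J (sorted_list J ! i))"
    by (rule sum.reindex_bij_betw [OF bij_betw_nth_sorted_list [OF fin], symmetric])
  also have "\<dots> = (\<Sum>i<card J. sorted_list J ! i - (i + 2))"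
    using fin by (intro sum.cong) (auto simp: below_nth_sorted_list)
  also have "\<dots> = (\<Sum>t = 2..m. sorted_list J ! (t - 2) - t)"
    unfolding J(2)
    by (rule sum.reindex_bij_witness [where i = "\<lambda>t. t - 2" and j = "\<lambda>i. i + 2"]) auto
  finally show ?thesis by simp
qed

section \<open>Permutations sorted by their first value\<close>

definition skip :: "nat \<Rightarrow> nat \<Rightarrow> nat"
  where "skip t k = (if k < t then k else Suc k)"

text \<open>The first value is \<open>t\<close>, and \<open>skip t\<close> spreads the values of
  \<open>\<tau>\<close> increasingly over the remaining ones. Beyond \<open>n\<close> it is the
  identity, as \<open>permutes\<close> demands.\<close>

definition perm_Cons :: "nat \<Rightarrow> nat \<times> (nat \<Rightarrow> nat) \<Rightarrow> nat \<Rightarrow> nat"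
  where "perm_Cons n = (\<lambda>(t, \<tau>) r. if r = 0 then t else if r \<le> n then skip t (\<tau> (r - 1)) else r)"

lemma skip_simps [simp]: "skip t k \<noteq> t" "t \<noteq> skip t k" "skip t k = skip t k' \<longleftrightarrow> k = k'"
    "skip t k < skip t k' \<longleftrightarrow> k < k'" "skip t k < t \<longleftrightarrow> k < t"
  by (auto simp: skip_def)

lemma perm_Cons_permutes:
  assumes "t < Suc n" "\<tau> permutes {..<n}"
  shows "perm_Cons n (t, \<tau>) permutes {..<Suc n}"
proof (rule bij_imp_permutes)
  have "inj_on (perm_Cons n (t, \<tau>)) {..<Suc n}"
  proof (rule inj_onI)
    fix u v assume uv: "u \<in> {..<Suc n}" "v \<in> {..<Suc n}" "perm_Cons n (t, \<tau>) u = perm_Cons n (t, \<tau>) v"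
    then show "u = v"
      using injD [OF permutes_inj [OF assms(2)], of "u - 1" "v - 1"]
      by (cases u; cases v) (simp_all add: perm_Cons_def)
  qed
  moreover have "skip t (\<tau> (r - 1)) < Suc n" if "r \<noteq> 0" "r \<le> n" for r
    using permutes_in_image [OF assms(2), of "r - 1"] that by (auto simp: skip_def)
  then have "perm_Cons n (t, \<tau>) ` {..<Suc n} \<subseteq> {..<Suc n}"
    using assms(1) by (auto simp: perm_Cons_def)
  ultimately show "bij_betw (perm_Cons n (t, \<tau>)) {..<Suc n} {..<Suc n}"
    by (simp add: bij_betw_def endo_inj_surj)
qed (auto simp: perm_Cons_def)

text \<open>Surjectivity follows from injectivity by counting: both sides have (n + 1)!
  elements.\<close>

lemma bij_betw_perm_Cons:
  "bij_betw (perm_Cons n) ({..<Suc n} \<times> {\<tau>. \<tau> permutes {..<n}}) {\<sigma>. \<sigma> permutes {..<Suc n}}"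
    (is "bij_betw _ ?X ?Y")
proof -
  have inj: "inj_on (perm_Cons n) ?X"
  proof (rule inj_onI, clarify)
    fix t \<tau> t' \<tau>'
    assume eq: "perm_Cons n (t, \<tau>) = perm_Cons n (t', \<tau>')"
      and perm: "\<tau> permutes {..<n}" "\<tau>' permutes {..<n}"
    have t: "t = t'" using fun_cong [OF eq, of 0] by (simp add: perm_Cons_def)
    moreover have "\<tau> k = \<tau>' k" for k
    proof (cases "k < n")
      case True
      then show ?thesis using fun_cong [OF eq, of "Suc k"] t by (simp add: perm_Cons_def)
    next
      case False
      then show ?thesis using perm by (simp add: permutes_not_in)
    qed
    ultimately show "t = t' \<and> \<tau> = \<tau>'" by auto
  qed
  have "card (perm_Cons n ` ?X) = card ?Y"
    using card_image [OF inj] by (simp add: card_cartesian_product card_permutations)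
  moreover have "perm_Cons n ` ?X \<subseteq> ?Y" using perm_Cons_permutes by auto
  moreover have "finite ?Y" by (simp add: finite_permutations)
  ultimately have "perm_Cons n ` ?X = ?Y" by (intro card_subset_eq) auto
  with inj show ?thesis by (simp add: bij_betw_def)
qed

text \<open>Position 0 forms an inversion with each of the \<open>t\<close> values below
  \<open>t\<close>, all of which occur later. The other inversions are those of
  \<open>\<tau>\<close>, because \<open>skip t\<close> is increasing.\<close>

lemma num_inversions_perm_Cons:
  assumes "t < Suc n" "\<tau> permutes {..<n}"
  shows "num_inversions (Suc n) (perm_Cons n (t, \<tau>)) = t + num_inversions n \<tau>"
proof -
  let ?\<sigma> = "perm_Cons n (t, \<tau>)"
  let ?A = "{k. k < n \<and> \<tau> k < t}" and ?B = "{(u, v). u < v \<and> v < n \<and> \<tau> v < \<tau> u}"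
  have "{(u, v). u < v \<and> v < Suc n \<and> ?\<sigma> v < ?\<sigma> u} = (\<lambda>k. (0, Suc k)) ` ?A \<union> map_prod Suc Suc ` ?B"
    (is "?L = ?R")
  proof (rule Set.set_eqI)
    fix x :: "nat \<times> nat"
    obtain u v where x: "x = (u, v)" by (cases x)
    show "x \<in> ?L \<longleftrightarrow> x \<in> ?R"
      unfolding x by (cases u; cases v) (auto simp: perm_Cons_def image_iff)
  qed
  moreover have "card ((\<lambda>k. (0::nat, Suc k)) ` ?A \<union> map_prod Suc Suc ` ?B) = card ?A + card ?B"
  proof -
    have "finite ?A" "finite ?B"
      by (auto intro: finite_subset [of _ "{..<n}"] finite_subset [of _ "{..<n} \<times> {..<n}"])
    then show ?thesis
      by (subst card_Un_disjoint) (auto simp: card_image inj_on_def)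
  qed
  moreover have "card ?A = t"
  proof -
    have "\<tau> ` ?A = {..<t}"
    proof (intro equalityI subsetI)
      fix y assume y: "y \<in> {..<t}"
      then have "y \<in> \<tau> ` {..<n}" using permutes_image [OF assms(2)] assms(1) by auto
      then show "y \<in> \<tau> ` ?A" using y by auto
    qed auto
    moreover have "card (\<tau> ` ?A) = card ?A"
      using permutes_inj [OF assms(2)] by (intro card_image) (auto intro: inj_on_subset)
    ultimately show ?thesis by simp
  qed
  ultimately show ?thesis by (simp add: num_inversions_def)
qed

section \<open>Comparison of row-ordered and column-ordered minors\<close>

context qmatrix_cong
begin

definition row_minor :: "nat list \<Rightarrow> nat list \<Rightarrow> 'r"
  where "row_minor is js = (\<Sum>\<sigma>\<in>{\<sigma>. \<sigma> permutes {..<length is}}.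
    z ^ num_inversions (length is) \<sigma> * prod_list (map (\<lambda>r. a (is ! r) (js ! \<sigma> r)) [0..<length is]))"

text \<open>Permutations are grouped by their first value \<open>t\<close>. The expansion is exact,
  since the entry of the first row already stands in front.\<close>

lemma row_minor_Cons:
  assumes "length js = Suc (length is)"
  shows "row_minor (i # is) js =
    (\<Sum>t<Suc (length is). z ^ t * a i (js ! t) * row_minor is (take t js @ drop (Suc t) js))"
proof -
  let ?n = "length is"
  have term_eq: "z ^ num_inversions (Suc ?n) (perm_Cons ?n (t, \<tau>)) *
      prod_list (map (\<lambda>r. a ((i # is) ! r) (js ! perm_Cons ?n (t, \<tau>) r)) [0..<Suc ?n]) =
      z ^ t * a i (js ! t) * (z ^ num_inversions ?n \<tau> *
        prod_list (map (\<lambda>r. a (is ! r) ((take t js @ drop (Suc t) js) ! \<tau> r)) [0..<?n]))"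
    if t: "t < Suc ?n" and \<tau>: "\<tau> permutes {..<?n}" for t \<tau>
  proof -
    have "(take t js @ drop (Suc t) js) ! k = js ! skip t k" for k
      using assms t by (auto simp: nth_append skip_def min_def)
    then have "map (\<lambda>r. a ((i # is) ! r) (js ! perm_Cons ?n (t, \<tau>) r)) [0..<Suc ?n] =
        a i (js ! t) # map (\<lambda>r. a (is ! r) ((take t js @ drop (Suc t) js) ! \<tau> r)) [0..<?n]"
      by (simp add: upt_conv_Cons perm_Cons_def map_Suc_upt [symmetric] del: upt_Suc)
    then show ?thesis
      using num_inversions_perm_Cons [OF t \<tau>] by (simp add: power_add mult.assoc commute_z_minor)
  qed
  have "row_minor (i # is) js = (\<Sum>\<sigma>\<in>{\<sigma>. \<sigma> permutes {..<Suc ?n}}. z ^ num_inversions (Suc ?n) \<sigma> *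
      prod_list (map (\<lambda>r. a ((i # is) ! r) (js ! \<sigma> r)) [0..<Suc ?n]))"
    unfolding row_minor_def by simp
  also have "\<dots> = (\<Sum>x\<in>{..<Suc ?n} \<times> {\<tau>. \<tau> permutes {..<?n}}. z ^ num_inversions (Suc ?n) (perm_Cons ?n x) *
      prod_list (map (\<lambda>r. a ((i # is) ! r) (js ! perm_Cons ?n x r)) [0..<Suc ?n]))"
    by (rule sum.reindex_bij_betw [OF bij_betw_perm_Cons, symmetric])
  also have "\<dots> = (\<Sum>(t, \<tau>)\<in>{..<Suc ?n} \<times> {\<tau>. \<tau> permutes {..<?n}}. z ^ t * a i (js ! t) *
      (z ^ num_inversions ?n \<tau> *
        prod_list (map (\<lambda>r. a (is ! r) ((take t js @ drop (Suc t) js) ! \<tau> r)) [0..<?n])))"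
    by (intro sum.cong refl) (use term_eq in auto)
  also have "\<dots> = (\<Sum>t<Suc ?n. z ^ t * a i (js ! t) * row_minor is (take t js @ drop (Suc t) js))"
    unfolding row_minor_def sum_distrib_left by (rule sum.cartesian_product [symmetric])
  finally show ?thesis .
qed

text \<open>Both sides have the same expansion along the first row: \<open>row_minor\<close>
  formally, \<open>minor\<close> by \<open>minor_row_expansion\<close>.\<close>

lemma row_minor_cong_minor:
  assumes "sorted_wrt (<) is" "finite D" "card D = length is"
  shows "row_minor is (sorted_list D) \<approx> minor (set is) (sorted_list D)"
  using assms
proof (induction "is" arbitrary: D)
  case Nil
  then show ?case by (simp add: row_minor_def num_inversions_def one)
next
  case (Cons i "is")
  let ?js = "sorted_list D"
  have "row_minor (i # is) ?js =
      (\<Sum>t<card D. z ^ t * a i (?js ! t) * row_minor is (take t ?js @ drop (Suc t) ?js))"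
    using Cons.prems by (simp add: row_minor_Cons)
  also have "\<dots> = (\<Sum>t<card D. z ^ below D (?js ! t) * a i (?js ! t) * row_minor is (sorted_list (D - {?js ! t})))"
  proof (intro sum.cong refl)
    fix t assume t: "t \<in> {..<card D}"
    have js: "?js = take t ?js @ ?js ! t # drop (Suc t) ?js"
      using t by (intro id_take_nth_drop) simp
    have "sorted_wrt (<) (take t ?js @ ?js ! t # drop (Suc t) ?js)"
      using strict_sorted_list_of_set [of D] unfolding js [symmetric] .
    moreover have "set (take t ?js @ ?js ! t # drop (Suc t) ?js) = D"
      unfolding js [symmetric] using Cons.prems(2) by simp
    ultimately have "take t ?js @ drop (Suc t) ?js = sorted_list (D - {?js ! t})"
      using Cons.prems(2)
      by (intro strict_sorted_equal) (auto simp: sorted_wrt_append simp del: append_take_drop_id)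
    then show "z ^ t * a i (?js ! t) * row_minor is (take t ?js @ drop (Suc t) ?js) =
        z ^ below D (?js ! t) * a i (?js ! t) * row_minor is (sorted_list (D - {?js ! t}))"
      using t Cons.prems(2) by (simp add: below_nth_sorted_list)
  qed
  also have "\<dots> = (\<Sum>c\<in>D. z ^ below D c * a i c * row_minor is (sorted_list (D - {c})))"
    by (rule sum.reindex_bij_betw [OF bij_betw_nth_sorted_list [OF Cons.prems(2)]])
  also have "\<dots> \<approx> (\<Sum>c\<in>D. z ^ below D c * a i c * minor (set is) (sorted_list (D - {c})))"
    using Cons.prems by (intro sum mult z_power entry Cons.IH) auto
  also have "\<dots> \<approx> minor (set (i # is)) (sorted_list D)"
    using Cons.prems minor_row_expansion [of D "set is" i] by (auto intro: sym)
  finally show ?case .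
qed

lemma bracket_refl: "(\<And>I. b I \<approx> b I) \<Longrightarrow> bracket m b p S \<approx> bracket m b p S"
  by (induction p arbitrary: S) (auto intro!: sum mult z_power)

end

text \<open>\<open>h\<close> has to respect the operations only on elements related to themselves.
  The central element \<open>z\<close> turns into the scalar -q, since brackets and minors in
  \<open>A\<close> carry their signs through the scalar action.\<close>

locale qmatrix_hom = qmatrix_cong rel a z r
  for rel :: "'r::ring_1 \<Rightarrow> 'r \<Rightarrow> bool"  (infix "\<approx>" 50)
    and a :: "nat \<Rightarrow> nat \<Rightarrow> 'r" and z r :: 'r +
  fixes A :: "(complex, 'b) module" and h :: "'r \<Rightarrow> 'b" and q :: complex
  assumes abelian: "abelian_monoid A"
    and hom_closed: "x \<approx> x \<Longrightarrow> h x \<in> carrier A"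
    and hom_cong: "x \<approx> y \<Longrightarrow> h x = h y"
    and hom_zero: "h 0 = \<zero>\<^bsub>A\<^esub>" and hom_one: "h 1 = \<one>\<^bsub>A\<^esub>"
    and hom_add: "x \<approx> x \<Longrightarrow> y \<approx> y \<Longrightarrow> h (x + y) = h x \<oplus>\<^bsub>A\<^esub> h y"
    and hom_mult: "x \<approx> x \<Longrightarrow> y \<approx> y \<Longrightarrow> h (x * y) = h x \<otimes>\<^bsub>A\<^esub> h y"
    and hom_smult: "x \<approx> x \<Longrightarrow> h (z ^ n * x) = (- q) ^ n \<odot>\<^bsub>A\<^esub> h x"
begin

lemma hom_sum:
  "\<lbrakk>finite X; \<And>x. x \<in> X \<Longrightarrow> f x \<approx> f x\<rbrakk> \<Longrightarrow> h (sum f X) = (\<Oplus>\<^bsub>A\<^esub>x\<in>X. h (f x))"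
proof (induction X rule: finite_induct)
  case empty
  then show ?case by (simp add: abelian_monoid.finsum_empty [OF abelian] hom_zero)
next
  case (insert x X)
  then show ?case
    using abelian_monoid.finsum_insert [OF abelian, of X x "\<lambda>x. h (f x)"]
    by (simp add: hom_add sum Pi_iff hom_closed)
qed

lemma prod_list_refl: "(\<And>x. x \<in> set xs \<Longrightarrow> x \<approx> x) \<Longrightarrow> prod_list xs \<approx> prod_list xs"
  by (induction xs) (auto intro: one mult)

lemma hom_prod_list: "(\<And>x. x \<in> set xs \<Longrightarrow> x \<approx> x) \<Longrightarrow> h (prod_list xs) = list_mult A (map h xs)"
proof (induction xs)
  case (Cons x xs)
  then show ?case by (simp add: list_mult_def hom_mult prod_list_refl)
qed (simp add: list_mult_def hom_one)

text \<open>\<open>g\<close> is compared with \<open>a\<close> only at the indices that occur,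
  because the concrete matrices match the images of \<open>qmat_var\<close> only within their proper
  index ranges.\<close>

lemma qminor_eq_hom_minor:
  assumes "sorted_wrt (<) is" "finite D" "card D = length is"
    and g: "\<And>i j. \<lbrakk>i \<in> set is; j \<in> D\<rbrakk> \<Longrightarrow> g i j = h (a i j)"
  shows "qminor A q g is (sorted_list D) = h (minor (set is) (sorted_list D))"
proof -
  let ?n = "length is" and ?js = "sorted_list D"
  let ?f = "\<lambda>\<sigma>. prod_list (map (\<lambda>r. a (is ! r) (?js ! \<sigma> r)) [0..<?n])"
  have refl: "?f \<sigma> \<approx> ?f \<sigma>" for \<sigma>
    by (intro prod_list_refl) (auto intro: entry)
  have f: "list_mult A (map (\<lambda>r. g (is ! r) (?js ! \<sigma> r)) [0..<?n]) = h (?f \<sigma>)"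
    if "\<sigma> permutes {..<?n}" for \<sigma>
  proof -
    have "?js ! \<sigma> r \<in> D" if "r < ?n" for r
      using permutes_in_image [OF \<open>\<sigma> permutes {..<?n}\<close>, of r] that assms(2,3) nth_mem [of "\<sigma> r" ?js] by simp
    then have "map (\<lambda>r. g (is ! r) (?js ! \<sigma> r)) [0..<?n] = map h (map (\<lambda>r. a (is ! r) (?js ! \<sigma> r)) [0..<?n])"
      by (simp add: g)
    then show ?thesis
      by (simp only:) (rule hom_prod_list [symmetric], auto intro: entry)
  qed
  have "qminor A q g is ?js =
      (\<Oplus>\<^bsub>A\<^esub>\<sigma>\<in>{\<sigma>. \<sigma> permutes {..<?n}}. h (z ^ num_inversions ?n \<sigma> * ?f \<sigma>))"
    unfolding qminor_def
  proof (rule abelian_monoid.finsum_cong' [OF abelian HOL.refl])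
    show "(\<lambda>\<sigma>. h (z ^ num_inversions ?n \<sigma> * ?f \<sigma>)) \<in> {\<sigma>. \<sigma> permutes {..<?n}} \<rightarrow> carrier A"
      by (intro funcsetI hom_closed mult z_power refl)
  qed (simp add: f hom_smult refl)
  also have "\<dots> = h (row_minor is ?js)"
    unfolding row_minor_def
    by (intro hom_sum [symmetric] mult z_power refl) (simp add: finite_permutations)
  also have "\<dots> = h (minor (set is) ?js)"
    by (intro hom_cong row_minor_cong_minor assms)
  finally show ?thesis .
qed

text \<open>\<open>qbracket\<close> chooses positions, \<open>bracket\<close> chooses values. The
  strictly increasing map \<open>f\<close> from positions to values carries one choice to the other
  and preserves crossings, minima and sorted lists. \<open>X\<close> bounds the indices on which
  \<open>b'\<close> is known.\<close>

lemma qbracket_eq_hom_bracket: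
  assumes b: "\<And>I. b I \<approx> b I"
      "\<And>I. \<lbrakk>finite I; card I = m; I \<subseteq> X\<rbrakk> \<Longrightarrow> b' (sorted_list I) = h (b I)"
    and m: "1 \<le> m" and s: "sorted_wrt (<) s" "length s = m * (p + 1)" "set s \<subseteq> X"
  shows "qbracket A q m b' p s = h (bracket m b p (set s))"
  using s
proof (induction p arbitrary: s)
  case 0
  then show ?case
    using b(2) [of "set s"] distinct_card [of s]
    by (simp add: strict_sorted_iff sorted_list_of_set.idem_if_sorted_distinct)
next
  case (Suc p)
  define M where "M = m * (p + 2)"
  define f where "f j = s ! (j - 1)" for j
  have len: "length s = M" and M: "1 \<le> M" using Suc.prems m by (auto simp: M_def)
  have mono: "strict_mono_on {1..M} f"
    using sorted_wrt_nth_less [OF Suc.prems(1)] len by (auto simp: strict_mono_on_def f_def)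
  note inj = strict_mono_on_imp_inj_on [OF mono]
  have set_s: "set s = f ` {1..M}"
  proof -
    have "{1..M} = Suc ` {..<M}" by (simp add: image_Suc_lessThan)
    then have "f ` {1..M} = (!) s ` {..<M}" by (simp only: f_def image_image diff_Suc_1)
    then show ?thesis using len by (auto simp: set_conv_nth)
  qed
  note One_nat_def [simp del]
  have split: "{1..M} = insert 1 {2..M}" using M by auto
  have f1: "f 1 < x" if "x \<in> f ` {2..M}" for x
    using that strict_mono_onD [OF mono, of 1] by auto
  then have f1_notin: "f 1 \<notin> f ` {2..M}" by blast
  have Min: "Min (set s) = f 1"
    unfolding set_s split by (intro Min_eqI) (auto intro: less_imp_le f1)
  have rest: "set s - {f 1} = f ` {2..M}"
    unfolding set_s split using f1_notin by auto
  let ?Js = "{J. J \<subseteq> {2..M} \<and> card J = m - 1}"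
  let ?g = "\<lambda>J. z ^ crossings (insert (f 1) J) (set s - insert (f 1) J) *
    (b (insert (f 1) J) * bracket m b p (set s - insert (f 1) J))"
  have fin: "finite ?Js" by (rule finite_subset [of _ "Pow {2..M}"]) auto
  have inj': "inj_on f J" if "J \<subseteq> {2..M}" for J
    using inj by (rule inj_on_subset) (use that in auto)
  have "bracket m b (Suc p) (set s) = (\<Sum>J\<in>{J. J \<subseteq> f ` {2..M} \<and> card J = m - 1}. ?g J)"
    by (simp add: Min rest mult.assoc)
  also have "{J. J \<subseteq> f ` {2..M} \<and> card J = m - 1} = (`) f ` ?Js"
    using inj' by (auto simp: subset_image_iff card_image)
  also have "(\<Sum>J\<in>(`) f ` ?Js. ?g J) = (\<Sum>J\<in>?Js. ?g (f ` J))"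
  proof (subst sum.reindex)
    show "inj_on ((`) f) ?Js"
      by (rule inj_on_subset [OF inj_on_image_Pow [OF inj' [OF order_refl]]]) auto
  qed simp
  finally have "h (bracket m b (Suc p) (set s)) = h (\<Sum>J\<in>?Js. ?g (f ` J))"
    by simp
  also have "\<dots> = (\<Oplus>\<^bsub>A\<^esub>J\<in>?Js. h (?g (f ` J)))"
    by (intro hom_sum fin mult z_power b(1) bracket_refl)
  also have "\<dots> = qbracket A q m b' (Suc p) s"
    unfolding qbracket.simps M_def [symmetric] f_def [symmetric]
  proof (rule abelian_monoid.finsum_cong' [OF abelian refl, symmetric])
    show "(\<lambda>J. h (?g (f ` J))) \<in> ?Js \<rightarrow> carrier A"
      by (intro funcsetI hom_closed mult z_power b(1) bracket_refl)
  next
    fix J assume "J \<in> ?Js"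
    then have J: "J \<subseteq> {2..M}" "card J = m - 1" by auto
    have finJ: "finite J" using J(1) finite_subset by blast
    let ?I = "insert 1 J" and ?K = "{2..M} - J"
    have I: "?I \<subseteq> {1..M}" and K: "?K \<subseteq> {1..M}" using J M by auto
    have mono': "strict_mono_on ?I f" "strict_mono_on ?K f"
      using monotone_on_subset [OF mono I] monotone_on_subset [OF mono K] by simp_all
    have "{1..M} - ?I = ?K" by auto
    then have diff: "set s - insert (f 1) (f ` J) = f ` ?K"
      using inj_on_image_set_diff [OF inj Diff_subset I] by (simp add: set_s)
    have "card ?I = m"
      using J m finJ by (subst card_insert_disjoint) auto
    have "map f (1 # sorted_list J) = sorted_list (f ` ?I)"
    proof -
      have "sorted_list ?I = 1 # sorted_list J"
        using finJ J by (intro sorted_list_of_set_insert_min) auto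
      then show ?thesis using map_sorted_list [OF mono'(1)] finJ by simp
    qed
    moreover have "card (f ` ?I) = m"
      using card_image [OF inj_on_subset [OF inj I]] \<open>card ?I = m\<close> by simp
    moreover have "f ` ?I \<subseteq> X"
      using I Suc.prems(3) set_s by blast
    ultimately have b': "b' (map f (1 # sorted_list J)) = h (b (insert (f 1) (f ` J)))"
      using b(2) [of "f ` ?I"] finJ by simp
    have "crossings (insert (f 1) (f ` J)) (f ` ?K) = crossings ?I ?K"
      using crossings_image [OF mono I K] by simp
    \<comment> \<open>Position 1 is smaller than all of \<open>?K\<close> and contributes no
      crossing.\<close>
    also have "\<dots> = crossings J ?K"
      using finJ J by (subst crossings_insert_left) (auto intro!: below_eq_0)
    also have "\<dots> = (\<Sum>t = 2..m. sorted_list J ! (t - 2) - t)"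
      using sum_shift_eq_crossings [OF J] by simp
    finally have cross: "crossings (insert (f 1) (f ` J)) (f ` ?K) = \<dots>" .
    have "qbracket A q m b' p (map f (sorted_list ?K)) = h (bracket m b p (set (map f (sorted_list ?K))))"
    proof (rule Suc.IH)
      show "sorted_wrt (<) (map f (sorted_list ?K))"
        using map_sorted_list [OF mono'(2)] by simp
      show "length (map f (sorted_list ?K)) = m * (p + 1)"
        using J finJ m by (simp add: card_Diff_subset M_def algebra_simps)
      show "set (map f (sorted_list ?K)) \<subseteq> X"
        using Suc.prems(3) K set_s by auto
    qed
    then have "qbracket A q m b' p (map f (sorted_list ?K)) = h (bracket m b p (f ` ?K))"
      by simp
    then show "(- q) ^ (\<Sum>t = 2..m. sorted_list J ! (t - 2) - t) \<odot>\<^bsub>A\<^esub>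
        (b' (map f (1 # sorted_list J)) \<otimes>\<^bsub>A\<^esub> qbracket A q m b' p (map f (sorted_list ?K))) = h (?g (f ` J))"
      unfolding diff cross b' by (simp add: hom_smult hom_mult mult b(1) bracket_refl)
  qed
  finally show ?case ..
qed

end

subsection \<open>The quantum matrix algebra as a quotient\<close>

lemma Const_mult_commute: "Const c * p = p * (Const c :: 'x noncomm_poly)"
proof -
  have "p = (\<Sum>w\<in>Poly_Mapping.keys p. Poly_Mapping.single w (Poly_Mapping.lookup p w))"
    by (rule poly_mapping_eqI)
      (simp add: lookup_sum lookup_single when_def sum.If_cases Int_def in_keys_iff if_distrib sum.delta cong: if_cong)
  moreover have "Const c * (\<Sum>w\<in>Poly_Mapping.keys p. Poly_Mapping.single w (Poly_Mapping.lookup p w)) =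
      (\<Sum>w\<in>Poly_Mapping.keys p. Poly_Mapping.single w (Poly_Mapping.lookup p w)) * Const c"
    by (simp add: sum_distrib_left sum_distrib_right mult_single mult.commute)
  ultimately show ?thesis by simp
qed

lemma Const_power: "Const c ^ n = (Const (c ^ n) :: 'x noncomm_poly)"
  by (induction n) (simp_all add: mult_single)

lemma free_algebra_sel [simp]:
  "mult (free_algebra X) = (*)" "one (free_algebra X) = 1" "zero (free_algebra X) = 0"
  "add (free_algebra X) = (+)" "smult (free_algebra X) = (\<lambda>c p. Const c * p)"
  by (simp_all add: free_algebra_def)

lemma carrier_free_algebra:
  "p \<in> carrier (free_algebra X) \<longleftrightarrow> (\<forall>w\<in>Poly_Mapping.keys p. set (letters w) \<subseteq> X)"
  by (simp add: free_algebra_def)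

lemma free_algebra_closed [simp]:
  "0 \<in> carrier (free_algebra X)" "1 \<in> carrier (free_algebra X)"
  "Const c \<in> carrier (free_algebra X)" "Var x \<in> carrier (free_algebra X) \<longleftrightarrow> x \<in> X"
  by (auto simp: carrier_free_algebra zero_word_def Var_def)

lemma free_algebra_add_closed [intro]:
  "\<lbrakk>p \<in> carrier (free_algebra X); p' \<in> carrier (free_algebra X)\<rbrakk> \<Longrightarrow> p + p' \<in> carrier (free_algebra X)"
  unfolding carrier_free_algebra using keys_add [of p p'] by blast

lemma free_algebra_uminus_closed [intro]:
  "p \<in> carrier (free_algebra X) \<Longrightarrow> - p \<in> carrier (free_algebra X)"
  by (simp add: carrier_free_algebra)

lemma free_algebra_diff_closed [intro]:
  "\<lbrakk>p \<in> carrier (free_algebra X); p' \<in> carrier (free_algebra X)\<rbrakk> \<Longrightarrow> p - p' \<in> carrier (free_algebra X)"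
  using free_algebra_add_closed [of p X "- p'"] by auto

lemma free_algebra_mult_closed [intro]:
  assumes "p \<in> carrier (free_algebra X)" "p' \<in> carrier (free_algebra X)"
  shows "p * p' \<in> carrier (free_algebra X)"
  unfolding carrier_free_algebra
proof
  fix w assume "w \<in> Poly_Mapping.keys (p * p')"
  then obtain u v where "w = u + v" "u \<in> Poly_Mapping.keys p" "v \<in> Poly_Mapping.keys p'"
    using keys_mult [of p p'] by blast
  then show "set (letters w) \<subseteq> X"
    using assms by (auto simp: carrier_free_algebra plus_word_def)
qed

lemma ring_free_algebra: "ring (free_algebra X)"
proof (rule ringI)
  show "abelian_group (free_algebra X)"
  proof (rule abelian_groupI)
    fix p assume "p \<in> carrier (free_algebra X)"
    then show "\<exists>p'\<in>carrier (free_algebra X). p' \<oplus>\<^bsub>free_algebra X\<^esub> p = \<zero>\<^bsub>free_algebra X\<^esub>"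
      by (intro bexI [of _ "- p"]) auto
  qed (auto simp: add.assoc add.commute)
  show "Group.monoid (free_algebra X)"
    by (rule Group.monoidI) (auto simp: mult.assoc)
qed (auto simp: algebra_simps)

lemma quotient_algebra_sel [simp]:
  "carrier (quotient_algebra A I) = carrier (A Quot I)"
  "mult (quotient_algebra A I) = mult (A Quot I)" "one (quotient_algebra A I) = one (A Quot I)"
  "zero (quotient_algebra A I) = zero (A Quot I)" "add (quotient_algebra A I) = add (A Quot I)"
  "smult (quotient_algebra A I) = (\<lambda>c U. \<Union>x\<in>U. I +>\<^bsub>A\<^esub> (c \<odot>\<^bsub>A\<^esub> x))"
  by (simp_all add: quotient_algebra_def ring.defs module.defs)

lemma qmat_relations_closed: "qmat_relations q N \<subseteq> carrier (free_algebra ({1..N} \<times> {1..N}))"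
  unfolding qmat_relations_def Let_def
  by (intro Un_least subsetI; clarify; intro free_algebra_diff_closed free_algebra_mult_closed; simp)

lemma ideal_qmat: "ideal (qmat_ideal q N) (free_algebra ({1..N} \<times> {1..N}))"
  unfolding qmat_ideal_def by (intro ring.genideal_ideal ring_free_algebra qmat_relations_closed)

lemma qmat_relations_subset: "qmat_relations q N \<subseteq> qmat_ideal q N"
  unfolding qmat_ideal_def by (intro ring.genideal_self ring_free_algebra qmat_relations_closed)

definition qmat_coset :: "complex \<Rightarrow> nat \<Rightarrow> (nat \<times> nat) noncomm_poly \<Rightarrow> (nat \<times> nat) noncomm_poly set"
  where "qmat_coset q N p = qmat_ideal q N +>\<^bsub>free_algebra ({1..N} \<times> {1..N})\<^esub> p"

text \<open>The type also contains variables with indices outside the matrix, so reflexivity is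
  restricted to the free algebra on the proper generators.\<close>

definition qmat_rel :: "complex \<Rightarrow> nat \<Rightarrow> (nat \<times> nat) noncomm_poly \<Rightarrow> (nat \<times> nat) noncomm_poly \<Rightarrow> bool"
  where "qmat_rel q N x y \<longleftrightarrow> x \<in> carrier (free_algebra ({1..N} \<times> {1..N})) \<and>
    y \<in> carrier (free_algebra ({1..N} \<times> {1..N})) \<and> qmat_coset q N x = qmat_coset q N y"

text \<open>The matrix is extended by the identity also at index 0, so that the defining relations hold
  for all natural numbers as indices.\<close>

definition qmat_var :: "nat \<Rightarrow> nat \<Rightarrow> nat \<Rightarrow> (nat \<times> nat) noncomm_poly"
  where "qmat_var N i j = (if i \<in> {1..N} \<and> j \<in> {1..N} then Var (i, j) else if i = j then 1 else 0)"

section \<open>The relations for the extended matrix\<close>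

context
  fixes q :: complex and N :: nat
  notes One_nat_def [simp del]
begin

abbreviation "F \<equiv> free_algebra ({1..N} \<times> {1..N})"

lemma coset_hom:
  shows qmat_coset_closed: "x \<in> carrier F \<Longrightarrow> qmat_coset q N x \<in> carrier (qmat_algebra q N)"
    and qmat_coset_mult: "\<lbrakk>x \<in> carrier F; y \<in> carrier F\<rbrakk> \<Longrightarrow>
      qmat_coset q N (x * y) = qmat_coset q N x \<otimes>\<^bsub>qmat_algebra q N\<^esub> qmat_coset q N y"
    and qmat_coset_add: "\<lbrakk>x \<in> carrier F; y \<in> carrier F\<rbrakk> \<Longrightarrow>
      qmat_coset q N (x + y) = qmat_coset q N x \<oplus>\<^bsub>qmat_algebra q N\<^esub> qmat_coset q N y"
    and qmat_coset_one: "qmat_coset q N 1 = \<one>\<^bsub>qmat_algebra q N\<^esub>"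
  using ring_hom_memE [OF ideal.rcos_ring_hom [OF ideal_qmat]]
  by (simp_all add: qmat_algebra_def qmat_coset_def)

lemma qmat_coset_ideal:
  assumes "x \<in> qmat_ideal q N"
  shows "qmat_coset q N x = \<zero>\<^bsub>qmat_algebra q N\<^esub>"
  using ring.a_rcos_zero [OF ring_free_algebra ideal_qmat assms]
  by (simp add: qmat_algebra_def qmat_coset_def FactRing_def)

lemma qmat_coset_zero: "qmat_coset q N 0 = \<zero>\<^bsub>qmat_algebra q N\<^esub>"
  using qmat_coset_ideal additive_subgroup.zero_closed [OF ideal.axioms(1) [OF ideal_qmat]] by simp

lemma abelian_monoid_qmat_algebra: "abelian_monoid (qmat_algebra q N)"
proof -
  interpret Q: ring "F Quot qmat_ideal q N"
    by (rule ideal.quotient_is_ring [OF ideal_qmat])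
  show ?thesis
    unfolding qmat_algebra_def
    by (rule abelian_monoidI) (simp_all add: Q.a_assoc Q.a_comm Q.a_lcomm)
qed

lemma qmat_coset_eqI:
  assumes "x \<in> carrier F" "y \<in> carrier F" "x - y \<in> qmat_ideal q N"
  shows "qmat_coset q N x = qmat_coset q N y"
proof -
  interpret Q: abelian_monoid "qmat_algebra q N" by (rule abelian_monoid_qmat_algebra)
  have "qmat_coset q N ((x - y) + y) = \<zero>\<^bsub>qmat_algebra q N\<^esub> \<oplus>\<^bsub>qmat_algebra q N\<^esub> qmat_coset q N y"
    using qmat_coset_add [of "x - y" y] assms qmat_coset_ideal [OF assms(3)] by auto
  then show ?thesis using Q.l_zero [OF qmat_coset_closed [OF assms(2)]] by simp
qed

text \<open>The scalar action on a coset is a union over its representatives. All of them yield the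
  same coset, since scaling is multiplication by \<open>Const c\<close>, and \<open>x\<close> itself
  is one of them.\<close>

lemma qmat_coset_smult:
  assumes x: "x \<in> carrier F"
  shows "qmat_coset q N (Const c * x) = c \<odot>\<^bsub>qmat_algebra q N\<^esub> qmat_coset q N x"
proof -
  interpret I: ideal "qmat_ideal q N" F by (rule ideal_qmat)
  have "qmat_coset q N (Const c * y) = qmat_coset q N (Const c * x)" if y: "y \<in> qmat_coset q N x" for y
  proof -
    have "y \<in> carrier F"
      using y x I.a_elemrcos_carrier [of x y] by (simp add: qmat_coset_def)
    moreover have "qmat_coset q N y = qmat_coset q N x"
      using I.a_repr_independence' [of y x] y x by (simp add: qmat_coset_def)
    ultimately show ?thesis using x by (simp add: qmat_coset_mult)
  qed
  moreover have "x \<in> qmat_coset q N x"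
    using I.a_rcos_self [OF x] by (simp add: qmat_coset_def)
  ultimately have "(\<Union>y\<in>qmat_coset q N x. qmat_coset q N (Const c * y)) = qmat_coset q N (Const c * x)"
    by blast
  then show ?thesis
    by (simp add: qmat_algebra_def qmat_coset_def)
qed

lemma qmat_coset_diff:
  assumes "qmat_rel q N x y" "qmat_rel q N u v"
  shows "qmat_rel q N (x - u) (y - v)"
proof -
  \<comment> \<open>Reduces subtraction to the sums and products that the coset map is known to
    respect.\<close>
  have minus: "x - u = x + Const (- 1) * u" for x u :: "(nat \<times> nat) noncomm_poly"
    by (simp add: single_uminus)
  show ?thesis
    using assms unfolding qmat_rel_def minus
    by (auto simp: qmat_coset_add qmat_coset_mult free_algebra_mult_closed)
qed

lemma qmat_var_closed: "qmat_var N i j \<in> carrier F"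
  by (simp add: qmat_var_def)

lemma qmat_var_outside:
  "\<not> (i \<in> {1..N} \<and> j \<in> {1..N}) \<Longrightarrow> qmat_var N i j = (if i = j then 1 else 0)"
  by (auto simp: qmat_var_def)

lemma qmat_relI:
  assumes "x \<in> carrier F" "y \<in> carrier F" "x - y \<in> qmat_relations q N"
  shows "qmat_rel q N x y"
  unfolding qmat_rel_def using assms qmat_coset_eqI [of x y] qmat_relations_subset [of q N] by blast

lemma qmat_rel_refl: "x \<in> carrier F \<Longrightarrow> qmat_rel q N x x"
  by (simp add: qmat_rel_def)

lemma qmat_rel_same_row:
  assumes "k < l"
  shows "qmat_rel q N (qmat_var N i k * qmat_var N i l) (Const q * qmat_var N i l * qmat_var N i k)"
proof (cases "i \<in> {1..N} \<and> k \<in> {1..N} \<and> l \<in> {1..N}")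
  case True
  then have "Var (i, k) * Var (i, l) - Const q * Var (i, l) * Var (i, k) \<in> qmat_relations q N"
    unfolding qmat_relations_def Let_def using assms by (intro UnI1) blast
  then show ?thesis
    using True by (intro qmat_relI free_algebra_mult_closed qmat_var_closed) (simp_all add: qmat_var_def)
next
  case False
  \<comment> \<open>If \<open>i\<close> is out of range, row \<open>i\<close> is that of the
    identity matrix and cannot be nonzero in two columns. Otherwise a column out of range has 0 in
    row \<open>i\<close>.\<close>
  then have "qmat_var N i k = 0 \<or> qmat_var N i l = 0"
    unfolding qmat_var_def using assms by (cases "i = k"; cases "i = l"; auto)
  then show ?thesis by (auto simp: qmat_rel_refl)
qed

lemma qmat_rel_same_column:
  assumes "i < j"
  shows "qmat_rel q N (qmat_var N i k * qmat_var N j k) (Const q * qmat_var N j k * qmat_var N i k)"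
proof (cases "i \<in> {1..N} \<and> j \<in> {1..N} \<and> k \<in> {1..N}")
  case True
  then have "Var (i, k) * Var (j, k) - Const q * Var (j, k) * Var (i, k) \<in> qmat_relations q N"
    unfolding qmat_relations_def Let_def using assms by (intro UnI1 [OF UnI1 [OF UnI2]]) blast
  then show ?thesis
    using True by (intro qmat_relI free_algebra_mult_closed qmat_var_closed) (simp_all add: qmat_var_def)
next
  case False
  then have "qmat_var N i k = 0 \<or> qmat_var N j k = 0"
    unfolding qmat_var_def using assms by (cases "i = k"; cases "j = k"; auto)
  then show ?thesis by (auto simp: qmat_rel_refl)
qed

lemma qmat_var_commute_outside:
  assumes "\<not> (i \<in> {1..N} \<and> j \<in> {1..N})"
  shows "qmat_var N i j * x = x * qmat_var N i j"
  unfolding qmat_var_outside [OF assms] by simp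

lemma qmat_rel_commute:
  assumes "i < j" "k < l"
  shows "qmat_rel q N (qmat_var N j k * qmat_var N i l) (qmat_var N i l * qmat_var N j k)"
proof (cases "(i \<in> {1..N} \<and> l \<in> {1..N}) \<and> (j \<in> {1..N} \<and> k \<in> {1..N})")
  case True
  then have "Var (j, k) * Var (i, l) - Var (i, l) * Var (j, k) \<in> qmat_relations q N"
    unfolding qmat_relations_def Let_def using assms by (intro UnI1 [OF UnI2]) blast
  then show ?thesis
    using True by (intro qmat_relI free_algebra_mult_closed qmat_var_closed) (simp_all add: qmat_var_def)
next
  case False
  then have "qmat_var N j k * qmat_var N i l = qmat_var N i l * qmat_var N j k"
    using qmat_var_commute_outside [of j k] qmat_var_commute_outside [of i l] by metis
  then show ?thesis by (simp add: qmat_rel_refl free_algebra_mult_closed qmat_var_closed)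
qed

lemma qmat_rel_cross:
  assumes "i < j" "k < l"
  shows "qmat_rel q N (qmat_var N i k * qmat_var N j l - qmat_var N j l * qmat_var N i k)
    (Const (q - inverse q) * qmat_var N i l * qmat_var N j k)"
proof (cases "(i \<in> {1..N} \<and> k \<in> {1..N}) \<and> (j \<in> {1..N} \<and> l \<in> {1..N})")
  case True
  then have "Var (i, k) * Var (j, l) - Var (j, l) * Var (i, k) -
      Const (q - inverse q) * Var (i, l) * Var (j, k) \<in> qmat_relations q N"
    unfolding qmat_relations_def Let_def using assms by (intro UnI2) blast
  then show ?thesis
    using True
    by (intro qmat_relI free_algebra_diff_closed free_algebra_mult_closed qmat_var_closed)
      (simp_all add: qmat_var_def)
next
  case False
  then have "qmat_var N i k * qmat_var N j l = qmat_var N j l * qmat_var N i k"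
    using qmat_var_commute_outside [of i k] qmat_var_commute_outside [of j l] by metis
  \<comment> \<open>A nonzero entry out of range is diagonal. If \<open>i = l\<close> is out of
    range, then \<open>k < i < j\<close>, so a nonzero entry at \<open>(j, k)\<close> would have
    both indices in the interval \<open>{1..N}\<close> and force \<open>i\<close> into it. The case
    \<open>j = k\<close> is similar, with \<open>i < j < l\<close>.\<close>
  moreover have "qmat_var N i l * qmat_var N j k = 0"
    using False assms by (auto simp: qmat_var_def)
  ultimately show ?thesis by (simp add: qmat_rel_refl mult.assoc)
qed

lemma qmatrix_hom_qmat_coset:
  assumes "q \<noteq> 0"
  shows "qmatrix_hom (qmat_rel q N) (qmat_var N) (Const (- q)) (Const (- inverse q))
    (qmat_algebra q N) (qmat_coset q N) q"
proof (intro qmatrix_hom.intro qmatrix_cong.intro qmatrix_hom_axioms.intro)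
  have minus: "- Const (- q) = Const q" "Const (- inverse q) - Const (- q) = Const (q - inverse q)"
    by (simp_all add: single_uminus single_diff)
  show "qmat_rel q N (qmat_var N i k * qmat_var N i l) (- Const (- q) * qmat_var N i l * qmat_var N i k)"
    if "k < l" for i k l
    unfolding minus using that by (rule qmat_rel_same_row)
  show "qmat_rel q N (qmat_var N i k * qmat_var N j k) (- Const (- q) * qmat_var N j k * qmat_var N i k)"
    if "i < j" for i j k
    unfolding minus using that by (rule qmat_rel_same_column)
  show "qmat_rel q N (qmat_var N j k * qmat_var N i l) (qmat_var N i l * qmat_var N j k)"
    if "i < j" "k < l" for i j k l
    using that by (rule qmat_rel_commute)
  show "qmat_rel q N (qmat_var N i k * qmat_var N j l - qmat_var N j l * qmat_var N i k)
      ((Const (- inverse q) - Const (- q)) * qmat_var N i l * qmat_var N j k)"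
    if "i < j" "k < l" for i j k l
    unfolding minus using that by (rule qmat_rel_cross)
  show "qmat_rel q N (x * u) (y * v)" if "qmat_rel q N x y" "qmat_rel q N u v" for x y u v
    using that by (auto simp: qmat_rel_def qmat_coset_mult)
  show "Const (- q) * Const (- inverse q) = 1"
    using assms by (simp add: mult_single)
  show "qmat_coset q N (Const (- q) ^ n * x) = (- q) ^ n \<odot>\<^bsub>qmat_algebra q N\<^esub> qmat_coset q N x"
    if "qmat_rel q N x x" for n x
    using that by (simp add: Const_power qmat_rel_def qmat_coset_smult)
  show "Const (- q) * x = x * Const (- q)" for x by (rule Const_mult_commute)
  show "qmat_rel q N (x - u) (y - v)" if "qmat_rel q N x y" "qmat_rel q N u v" for x y u v
    using that by (rule qmat_coset_diff)
  show "abelian_monoid (qmat_algebra q N)" by (rule abelian_monoid_qmat_algebra)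
qed (simp_all add: qmat_rel_def qmat_var_closed qmat_coset_closed qmat_coset_zero qmat_coset_one
    qmat_coset_add qmat_coset_mult)

lemma qmat_coset_var:
  assumes "1 \<le> i" "1 \<le> j"
  shows "qmat_coset q N (qmat_var N i j) = qmat_gen_ext q N i j"
  using assms
  by (simp add: qmat_var_def qmat_gen_ext_def qmat_gen_def qmat_coset_one qmat_coset_zero)
    (simp add: qmat_coset_def)

end

section \<open>The determinant identity\<close>

lemma sorted_list_of_set_upt: "sorted_list_of_set {i..j} = [i..<Suc j]"
  by (simp add: atLeastLessThanSuc_atLeastAtMost [symmetric] del: upt_Suc)

lemma blocks_atLeastAtMost: "blocks m {1..n} = {1..m * n}"
proof (induction n)
  case (Suc n)
  have "{1..Suc n} = insert (Suc n) {1..n}" by auto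
  moreover have "{1..m * Suc n} = {m * n + 1..m * Suc n} \<union> {1..m * n}" by auto
  ultimately show ?case using Suc by (simp add: blocks_insert block_def)
qed (simp add: blocks_def)

theorem corollary3p8:
  fixes k m n l :: nat and q :: complex
  assumes "k \<ge> 1" and "m = 2 * k" and "n \<ge> 1" and "1 \<le> l" and "l \<le> m - 1"
    and "q \<noteq> 0" and "q ^ (8 * (k choose 2)) = 1"
  shows "qdet (qmat_algebra q (m * n + l)) q (qmat_gen q (m * n + l)) (m * n + l) =
    qhyper_pfaffian (qmat_algebra q (m * n + l)) q m n
      (minor_sum (qmat_algebra q (m * n + l)) q (qmat_gen_ext q (m * n + l)) m n)"
proof -
  define N M where "N = m * n + l" and "M = m * (n + 1)"
  have m: "2 \<le> m" and NM: "N \<le> M" using assms(1-5) by (auto simp: N_def M_def)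
  let ?A = "qmat_algebra q N" and ?g = "qmat_gen_ext q N"
  interpret qmatrix_hom "qmat_rel q N" "qmat_var N" "Const (- q)" "Const (- inverse q)" ?A
      "qmat_coset q N" q
    by (rule qmatrix_hom_qmat_coset) fact
  have root: "Const (- q) ^ (m * (m - 2)) = (1 :: (nat \<times> nat) noncomm_poly)"
  proof -
    obtain d where k: "k = Suc d" using assms(1) by (cases k) auto
    \<comment> \<open>Makes the division by 2 in the binomial coefficient exact.\<close>
    have "even (k * (k - 1))" by (simp add: k)
    then have "8 * (k choose 2) = 4 * (k * (k - 1))" by (auto simp: choose_two)
    also have "\<dots> = m * (m - 2)" using assms(2) k by (simp add: algebra_simps)
    finally have "q ^ (m * (m - 2)) = 1" using assms(7) by simp
    \<comment> \<open>The hypothesis concerns powers of \<open>q\<close>, the exponents those of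
      \<open>-q\<close>; an even exponent removes the sign.\<close>
    moreover have "even (m * (m - 2))" using assms(2) by simp
    ultimately have "(- q) ^ (m * (m - 2)) = 1" by (simp only: power_minus_even)
    then show ?thesis by (simp only: Const_power single_one)
  qed
  let ?K = "{1..n + 1}"
  let ?b = "\<lambda>I. \<Sum>i\<in>?K. minor I (sorted_list (block m i))"
  have minor_sum: "minor_sum ?A q ?g m n (sorted_list I) = qmat_coset q N (?b I)"
    if I: "finite I" "card I = m" "I \<subseteq> {1..}" for I
  proof -
    have "qminor ?A q ?g (sorted_list I) (sorted_list (block m i)) =
        qmat_coset q N (minor I (sorted_list (block m i)))" if "i \<in> ?K" for i
    proof -
      have "qminor ?A q ?g (sorted_list I) (sorted_list (block m i)) =
          qmat_coset q N (minor (set (sorted_list I)) (sorted_list (block m i)))"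
      proof (rule qminor_eq_hom_minor)
        show "card (block m i) = length (sorted_list I)" using that I by (simp add: card_block)
        fix s t assume "s \<in> set (sorted_list I)" "t \<in> block m i"
        then have "1 \<le> s" "1 \<le> t" using I by (auto simp: block_def)
        then show "?g s t = qmat_coset q N (qmat_var N s t)" by (simp add: qmat_coset_var)
      qed simp_all
      then show ?thesis using I by simp
    qed
    then have "minor_sum ?A q ?g m n (sorted_list I) =
        (\<Oplus>\<^bsub>?A\<^esub>i\<in>?K. qmat_coset q N (minor I (sorted_list (block m i))))"
      unfolding minor_sum_def block_def sorted_list_of_set_upt
      by (intro abelian_monoid.finsum_cong' [OF abelian HOL.refl] funcsetI hom_closed minor_refl) simp
    also have "\<dots> = qmat_coset q N (?b I)"
      by (intro hom_sum [symmetric] minor_refl) simp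
    finally show ?thesis .
  qed
  have "qhyper_pfaffian ?A q m n (minor_sum ?A q ?g m n) =
      qbracket ?A q m (minor_sum ?A q ?g m n) n (sorted_list {1..M})"
    unfolding qhyper_pfaffian_def M_def sorted_list_of_set_upt by simp
  also have "\<dots> = qmat_coset q N (bracket m ?b n (set (sorted_list {1..M})))"
  \<comment> \<open>Index 0 is left out: there \<open>qmat_var\<close> and
    \<open>qmat_gen_ext\<close> are defined differently.\<close>
  proof (rule qbracket_eq_hom_bracket [where X = "{1..}"])
    show "qmat_rel q N (?b I) (?b I)" for I by (intro sum minor_refl)
    show "minor_sum ?A q ?g m n (sorted_list I) = qmat_coset q N (?b I)"
      if "finite I" "card I = m" "I \<subseteq> {1..}" for I
      using that by (rule minor_sum)
  qed (use m in \<open>auto simp: M_def\<close>)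
  also have "set (sorted_list {1..M}) = {1..M}" by simp
  also have "qmat_coset q N (bracket m ?b n {1..M}) = qmat_coset q N
      (\<Sum>T\<in>{T. T \<subseteq> ?K \<and> card T = n + 1}. minor {1..M} (sorted_list (blocks m T)))"
    using m root by (intro hom_cong bracket_eq_sum_minor) (auto simp: M_def)
  also have "{T. T \<subseteq> ?K \<and> card T = n + 1} = {?K}"
    using card_subset_eq [of ?K] by auto
  also have "(\<Sum>T\<in>{?K}. minor {1..M} (sorted_list (blocks m T))) = minor {1..M} (sorted_list {1..M})"
    using blocks_atLeastAtMost [of m "n + 1"] by (simp add: M_def)
  \<comment> \<open>The last rows and columns, from \<open>N + 1\<close> to \<open>M\<close>, are
    those of the identity matrix and are removed one at a time.\<close>
  also have "minor {1..M} (sorted_list {1..M}) = minor {1..N} (sorted_list {1..N})"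
    using NM
  proof (induction M rule: dec_induct)
    case (step p)
    have "{1..Suc p} = insert (Suc p) {1..p}" by auto
    moreover have "minor (insert (Suc p) {1..p}) (sorted_list {1..p} @ [Suc p]) = minor {1..p} (sorted_list {1..p})"
      using step.hyps by (intro minor_extend) (auto simp: qmat_var_def)
    ultimately show ?case
      using step.IH sorted_list_of_set_insert_max [of "{1..p}" "Suc p"] by simp
  qed simp
  also have "qmat_coset q N (minor {1..N} (sorted_list {1..N})) =
      qminor ?A q (qmat_gen q N) (sorted_list {1..N}) (sorted_list {1..N})"
  proof -
    have "qminor ?A q (qmat_gen q N) (sorted_list {1..N}) (sorted_list {1..N}) =
        qmat_coset q N (minor (set (sorted_list {1..N})) (sorted_list {1..N}))"
    proof (rule qminor_eq_hom_minor)
      fix i j assume "i \<in> set (sorted_list {1..N})" "j \<in> {1..N}"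
      then show "qmat_gen q N i j = qmat_coset q N (qmat_var N i j)"
        by (simp add: qmat_coset_var qmat_gen_ext_def)
    qed simp_all
    then show ?thesis by simp
  qed
  also have "\<dots> = qdet ?A q (qmat_gen q N) N"
    unfolding qdet_def sorted_list_of_set_upt ..
  finally show ?thesis by (simp add: N_def)
qed

end
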